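(* Let $K\ge 2$ and $L$ be integers with $B_K<L<K/2$, where $B_K=\frac{K-\sqrt{3K-2}}{2}$ if $K$ is even and $B_K=\frac{K-\sqrt{3K}}{2}$ if $K$ is odd. For $w\in[0,1/2]$ define the design $$\bar\xi(w)=w\,\bar\xi_L+(1-2w)\,\bar\xi_{K/2}+w\,\bar\xi_{K-L}\quad\text{if }K\text{ is even},$$ $$\bar\xi(w)=w\,\bar\xi_L+(\tfrac12-w)\,\bar\xi_{(K-1)/2}+(\tfrac12-w)\,\bar\xi_{(K+1)/2}+w\,\bar\xi_{K-L}\quad\text{if }K\text{ is odd}.$$ Let $\bar w_L^*\in[0,1/2]$ be an optimized weight, i.e. a maximizer of $w\mapsto\det\mathbf{M}(\bar\xi(w))$ over $[0,1/2]$. Then the symmetric invariant design $\bar\xi^*=\bar\xi(\bar w_L^* )$ is $D$-optimal on $\mathcal{X}_{L,K-L}$.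
   Context: Model: for $\bm{x}=(x_1,\dots,x_K)^\top\in\{-1,+1\}^K$ let $\bm{f}(\bm{x})=(1,\,x_1,\dots,x_K,\,x_1x_2,\dots,x_{K-1}x_K)^\top\in\mathbb{R}^p$ (constant, main effects $x_k$, and all two-factor interactions $x_jx_k$, $j<k$), so $p=1+K(K+1)/2$. A design $\xi$ is a probability measure on $\{-1,+1\}^K$ (finitely many points $\bm{x}_i$ with weights $w_i\ge 0$, $\sum_i w_i=1$); its information matrix is $\mathbf{M}(\xi)=\sum_i w_i\,\bm{f}(\bm{x}_i)\bm{f}(\bm{x}_i)^\top$. A design on a region $\mathcal{X}\subseteq\{-1,+1\}^K$ is a design whose support is contained in $\mathcal{X}$. A design on $\mathcal{X}$ is $D$-optimal on $\mathcal{X}$ if it maximizes $\det\mathbf{M}(\xi)$ among all designs $\xi$ on $\mathcal{X}$. Let $d(\bm{x})$ be the number of entries of $\bm{x}$ equal to $+1$, and $\mathcal{X}_{L,U}=\{\bm{x}\in\{-1,+1\}^K:\ L\le d(\bm{x})\le U\}$. For $0\le k\le K$ let $\mathcal{O}_k=\{\bm{x}: d(\bm{x})=k\}$ and let $\bar\xi_k$ be the uniform design on $\mathcal{O}_k$. A symmetric invariant design is one of the form $\sum_{k=0}^K\bar w_k\bar\xi_k$ with $\bar w_k\ge0$, $\sum_k\bar w_k=1$ and $\bar w_k=\bar w_{K-k}$ for all $k$. *)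

theory Defs
  imports Complex_Main "Jordan_Normal_Form.Determinant"
begin

text \<open>
  Vectors over \<open>{0..<K}\<close> stand for points with coordinates \<open>1, \<dots>, K\<close>: component \<open>i\<close> here is
  coordinate \<open>i + 1\<close>.
\<close>

definition cube :: "nat \<Rightarrow> real vec set" where
  "cube K = {x \<in> carrier_vec K. \<forall>i<K. x $ i \<in> {-1, 1}}"

definition num_params :: "nat \<Rightarrow> nat" where
  "num_params K = 1 + K * (K + 1) div 2"

definition regressors :: "nat \<Rightarrow> real vec \<Rightarrow> real vec" where
  "regressors K x = vec_of_list
     ([1] @ [x $ k. k \<leftarrow> [0..<K]] @ [x $ j * x $ k. j \<leftarrow> [0..<K], k \<leftarrow> [Suc j..<K]])"

text \<open>
  The model has \<open>num_params K\<close> parameters, so no index in the information matrix below is out of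
  range.
\<close>

lemma dim_regressors: "dim_vec (regressors K x) = num_params K"
proof -
  have *: "(\<Sum>j\<leftarrow>[0..<n]. K - Suc j) = n * (2 * K - n - 1) div 2" if "n \<le> K" for n
    using that
  proof (induction n)
    case 0
    then show ?case by simp
  next
    case (Suc n)
    then obtain m where K: "K = Suc n + m"
      using le_Suc_ex by blast
    have "Suc n * (2 * K - Suc n - 1) = n * (2 * K - n - 1) + 2 * (K - Suc n)"
      unfolding K by (simp add: algebra_simps)
    with Suc show ?case by simp
  qed
  have "K + K * (K - 1) div 2 = K * (K + 1) div 2"
    by (cases K) (simp_all add: algebra_simps)
  with *[of K] show ?thesis
    by (simp add: regressors_def num_params_def length_concat comp_def)
qed

text \<open>A design is represented by its weight function, which vanishes off its support.\<close>

definition design :: "nat \<Rightarrow> (real vec \<Rightarrow> real) \<Rightarrow> bool" where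
  "design K \<xi> \<longleftrightarrow> (\<forall>x. 0 \<le> \<xi> x) \<and> {x. \<xi> x \<noteq> 0} \<subseteq> cube K \<and> (\<Sum>x\<in>cube K. \<xi> x) = 1"

definition design_on :: "nat \<Rightarrow> real vec set \<Rightarrow> (real vec \<Rightarrow> real) \<Rightarrow> bool" where
  "design_on K X \<xi> \<longleftrightarrow> design K \<xi> \<and> {x. \<xi> x \<noteq> 0} \<subseteq> X"

definition information_matrix :: "nat \<Rightarrow> (real vec \<Rightarrow> real) \<Rightarrow> real mat" where
  "information_matrix K \<xi> = mat (num_params K) (num_params K)
     (\<lambda>(r, s). \<Sum>x\<in>cube K. \<xi> x * (regressors K x $ r * regressors K x $ s))"

definition D_optimal_on :: "nat \<Rightarrow> real vec set \<Rightarrow> (real vec \<Rightarrow> real) \<Rightarrow> bool" where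
  "D_optimal_on K X \<xi> \<longleftrightarrow> design_on K X \<xi> \<and>
     (\<forall>\<eta>. design_on K X \<eta> \<longrightarrow> det (information_matrix K \<eta>) \<le> det (information_matrix K \<xi>))"

definition num_plus :: "real vec \<Rightarrow> nat" where
  "num_plus x = card {i. i < dim_vec x \<and> x $ i = 1}"

definition region :: "nat \<Rightarrow> nat \<Rightarrow> nat \<Rightarrow> real vec set" where
  "region K L U = {x \<in> cube K. L \<le> num_plus x \<and> num_plus x \<le> U}"

definition orbit :: "nat \<Rightarrow> nat \<Rightarrow> real vec set" where
  "orbit K k = {x \<in> cube K. num_plus x = k}"

definition unif_design :: "nat \<Rightarrow> nat \<Rightarrow> real vec \<Rightarrow> real" where
  "unif_design K k x = (if x \<in> orbit K k then 1 / real (card (orbit K k)) else 0)"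

definition symmetric_invariant :: "nat \<Rightarrow> (real vec \<Rightarrow> real) \<Rightarrow> bool" where
  "symmetric_invariant K \<xi> \<longleftrightarrow> (\<exists>w :: nat \<Rightarrow> real.
     (\<forall>k\<le>K. 0 \<le> w k) \<and> (\<Sum>k\<le>K. w k) = 1 \<and> (\<forall>k\<le>K. w k = w (K - k)) \<and>
     \<xi> = (\<lambda>x. \<Sum>k\<le>K. w k * unif_design K k x))"

definition lower_bound :: "nat \<Rightarrow> real" where
  "lower_bound K =
     (if even K then (real K - sqrt (3 * real K - 2)) / 2 else (real K - sqrt (3 * real K)) / 2)"

definition mixed_design :: "nat \<Rightarrow> nat \<Rightarrow> real \<Rightarrow> real vec \<Rightarrow> real" where
  "mixed_design K L w x =
     (if even K
      then w * unif_design K L x + (1 - 2 * w) * unif_design K (K div 2) x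
         + w * unif_design K (K - L) x
      else w * unif_design K L x + (1 / 2 - w) * unif_design K ((K - 1) div 2) x
         + (1 / 2 - w) * unif_design K ((K + 1) div 2) x + w * unif_design K (K - L) x)"

end

theory Submission
  imports Defs
begin

text \<open>
  Averaging a design over coordinate permutations and the global sign change does not decrease the
  determinant, since the determinant is quasi-concave on positive semidefinite matrices and the
  group acts on the regressors by signed permutations. The information matrix of an invariant
  design depends only on the moments of \<open>T = (\<Sum>x\<^sub>i)\<^sup>2\<close> and \<open>T\<^sup>2\<close>. On the region, \<open>T\<close> lies between
  its values \<open>T\<^sub>0\<close> on the middle orbits and \<open>T\<^sub>1\<close> on the extreme orbits, so the moments lie on or
  below the chord \<open>E (T - T\<^sub>0) (T - T\<^sub>1) = 0\<close>, which is traced out by the mixed designs. The uniform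
  design on the whole cube has the identity as information matrix, hence maximal determinant, and
  its moments lie above the chord precisely because of the lower bound on \<open>L\<close>. Mixing it into the
  averaged design until the chord is reached gives, without loss of determinant, the moments of a
  mixed design.
\<close>

section \<open>Determinants of positive semidefinite matrices\<close>

text \<open>The uniform design on the cube is not supported in the region, yet mixing it in is
  harmless: only the information matrix of the mixture is used, and once the moments lie on the
  chord this matrix is also that of a mixed design, which does live on the region. The optimal
  weight is never computed; it enters only by comparison with the other mixed designs. The two
  moments suffice because the product of two regressors is a monomial of degree at most four. The
  sign change kills odd degrees, permutations leave the degree as the only parameter, and the
  elementary symmetric polynomials of degrees 2 and 4 are polynomials in \<open>T\<close>. The same
  polynomials have mean zero under the uniform design, which yields its moments and hence the
  constants in the bound on \<open>L\<close>. Quasi-concavity is proved through logarithms, hence in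
  the form of a positive threshold that passes from the summands to their mixture; singular
  competitors are treated apart.\<close>

definition psd :: "nat \<Rightarrow> (nat \<Rightarrow> nat \<Rightarrow> real) \<Rightarrow> bool" where
  "psd n A \<longleftrightarrow> (\<forall>i<n. \<forall>j<n. A i j = A j i) \<and> (\<forall>y. 0 \<le> (\<Sum>i<n. \<Sum>j<n. A i j * y i * y j))"

lemma psd_sym: "psd n A \<Longrightarrow> i < n \<Longrightarrow> j < n \<Longrightarrow> A i j = A j i"
  by (auto simp: psd_def)

lemma psd_form: "psd n A \<Longrightarrow> 0 \<le> (\<Sum>i<n. \<Sum>j<n. A i j * y i * y j)"
  by (auto simp: psd_def)

text \<open>Matrices stay plain index functions until a determinant is taken: a leading block is
  then the same function with a smaller bound, which suits the induction on pivots.\<close>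

abbreviation fmat :: "nat \<Rightarrow> (nat \<Rightarrow> nat \<Rightarrow> real) \<Rightarrow> real mat" where
  "fmat n A \<equiv> mat n n (\<lambda>(i, j). A i j)"

text \<open>The entries of the product of the transpose of \<open>R\<close> with \<open>A\<close>
  and \<open>R\<close>.\<close>

definition congruent_form :: "nat \<Rightarrow> (nat \<Rightarrow> nat \<Rightarrow> real) \<Rightarrow> (nat \<Rightarrow> nat \<Rightarrow> real) \<Rightarrow> nat \<Rightarrow> nat \<Rightarrow> real" where
  "congruent_form n R A i j = (\<Sum>a<n. \<Sum>b<n. A a b * R a i * R b j)"

lemma quadratic_form_Suc:
  fixes A :: "nat \<Rightarrow> nat \<Rightarrow> real"
  assumes "\<And>i. i < n \<Longrightarrow> A n i = A i n"
  shows "(\<Sum>i<Suc n. \<Sum>j<Suc n. A i j * y i * y j) =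
    (\<Sum>i<n. \<Sum>j<n. A i j * y i * y j) + 2 * y n * (\<Sum>i<n. A i n * y i) + A n n * (y n)\<^sup>2"
proof -
  have "(\<Sum>j<n. A n j * y n * y j) = y n * (\<Sum>i<n. A i n * y i)"
    unfolding sum_distrib_left using assms by (intro sum.cong) auto
  moreover have "(\<Sum>i<n. A i n * y i * y n) = y n * (\<Sum>i<n. A i n * y i)"
    by (simp add: sum_distrib_left mult_ac)
  ultimately show ?thesis
    by (simp add: sum.distrib power2_eq_square)
qed

lemma sum_mult_delta:
  fixes f :: "nat \<Rightarrow> real"
  assumes "c < n"
  shows "(\<Sum>b<n. f b * (if b = c then e else 0)) = f c * e"
proof -
  have "(\<Sum>b<n. f b * (if b = c then e else 0)) = (\<Sum>b<n. if b = c then f b * e else 0)"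
    by (intro sum.cong refl) auto
  with assms show ?thesis by simp
qed

lemma double_sum_mult_delta:
  fixes A :: "nat \<Rightarrow> nat \<Rightarrow> real"
  assumes "c < n" "d < n"
  shows "(\<Sum>a<n. \<Sum>b<n. A a b * (if a = c then e else 0) * (if b = d then e' else 0)) = A c d * e * e'"
  by (simp only: sum_mult_delta[OF assms(2), of "\<lambda>b. A _ b * _"]
      mult.commute[of _ e'] sum_distrib_left[symmetric] sum_mult_delta[OF assms(1)])

lemma psd_diag:
  assumes "psd n A" "i < n"
  shows "0 \<le> A i i"
proof -
  have "0 \<le> (\<Sum>k<n. \<Sum>j<n. A k j * (if k = i then 1 else 0) * (if j = i then 1 else 0))"
    using assms(1) by (rule psd_form)
  also have "\<dots> = A i i"
    using double_sum_mult_delta[OF assms(2) assms(2), of A 1 1] by simp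
  finally show ?thesis .
qed

lemma psd_zero_column:
  assumes A: "psd (Suc n) A" and z: "A n n = 0" and i: "i < n"
  shows "A i n = 0"
proof (rule ccontr)
  assume nz: "A i n \<noteq> 0"
  \<comment> \<open>With \<open>A n n = 0\<close> the form at this vector is
    \<open>A i i + 2 * y n * A i n\<close>; the last coordinate is solved for the value
    \<open>-1\<close>.\<close>
  define y where "y = (\<lambda>k. if k = n then - (A i i + 1) / (2 * A i n) else if k = i then 1 else 0 :: real)"
  have "(\<Sum>k<n. \<Sum>j<n. A k j * y k * y j)
      = (\<Sum>k<n. \<Sum>j<n. A k j * (if k = i then 1 else 0) * (if j = i then 1 else 0))"
    by (intro sum.cong refl) (auto simp: y_def)
  also have "\<dots> = A i i"
    using double_sum_mult_delta[OF i i, of A 1 1] by simp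
  finally have 1: "(\<Sum>k<n. \<Sum>j<n. A k j * y k * y j) = A i i" .
  have "(\<Sum>k<n. A k n * y k) = (\<Sum>k<n. if k = i then A k n else 0)"
    by (intro sum.cong refl) (auto simp: y_def)
  then have 2: "(\<Sum>k<n. A k n * y k) = A i n"
    using i by simp
  have sym: "A n k = A k n" if "k < n" for k
    using psd_sym[OF A] that by auto
  have "0 \<le> (\<Sum>k<Suc n. \<Sum>j<Suc n. A k j * y k * y j)"
    using A by (rule psd_form)
  also have "\<dots> = A i i + 2 * y n * A i n"
    using z by (simp only: quadratic_form_Suc[of n A, OF sym] 1 2)
  also have "\<dots> = -1"
    using nz by (simp add: y_def field_simps)
  finally show False by simp
qed

text \<open>Division by zero makes the pivot step uniform: a zero pivot forces its column to vanish.\<close>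

lemma psd_ldl:
  assumes "psd n A"
  shows "\<exists>L d. (\<forall>k<n. L k k = 1 \<and> 0 \<le> d k) \<and> (\<forall>k i. k < i \<longrightarrow> L k i = 0) \<and>
    (\<forall>i<n. \<forall>j<n. A i j = (\<Sum>k<n. d k * L k i * L k j))"
  using assms
proof (induction n arbitrary: A)
  case 0
  then show ?case by (intro exI[of _ "\<lambda>_ _. 0"] exI[of _ "\<lambda>_. 0"]) auto
next
  case (Suc n)
  define a where "a = A n n"
  have a: "0 \<le> a" using psd_diag[OF Suc.prems] by (simp add: a_def)
  have sym: "A i j = A j i" if "i < Suc n" "j < Suc n" for i j
    using psd_sym[OF Suc.prems] that by auto
  have z: "A i n = 0" if "a = 0" "i < n" for i
    using psd_zero_column[OF Suc.prems] that by (simp add: a_def)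
  \<comment> \<open>The Schur complement of the last pivot. For \<open>a = 0\<close> the subtracted
    term is a division by zero, so \<open>S\<close> is just the leading block.\<close>
  define S where "S i j = A i j - A i n * A j n / a" for i j
  have "psd n S"
    unfolding psd_def
  proof (intro conjI allI impI)
    show "S i j = S j i" if "i < n" "j < n" for i j
      using sym that by (simp add: S_def mult.commute)
    fix y :: "nat \<Rightarrow> real"
    define b where "b = (\<Sum>i<n. A i n * y i)"
    have b0: "b = 0" if "a = 0" using z that by (simp add: b_def)
    \<comment> \<open>Completing the square: this last coordinate minimises the form of
      \<open>A\<close>, and the minimum is the form of \<open>S\<close> at \<open>y\<close>.\<close>
    define y' where "y' = y(n := - b / a)"
    have "0 \<le> (\<Sum>i<Suc n. \<Sum>j<Suc n. A i j * y' i * y' j)"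
      using Suc.prems by (rule psd_form)
    also have "\<dots> = (\<Sum>i<n. \<Sum>j<n. A i j * y' i * y' j) + 2 * y' n * (\<Sum>i<n. A i n * y' i) + A n n * (y' n)\<^sup>2"
      by (rule quadratic_form_Suc) (simp add: sym)
    also have "(\<Sum>i<n. \<Sum>j<n. A i j * y' i * y' j) = (\<Sum>i<n. \<Sum>j<n. A i j * y i * y j)"
      by (intro sum.cong refl) (auto simp: y'_def)
    also have "(\<Sum>i<n. A i n * y' i) = b"
      unfolding b_def by (intro sum.cong refl) (auto simp: y'_def)
    also have "(\<Sum>i<n. \<Sum>j<n. A i j * y i * y j) + 2 * y' n * b + A n n * (y' n)\<^sup>2
        = (\<Sum>i<n. \<Sum>j<n. A i j * y i * y j) - b * b / a"
      using b0 by (cases "a = 0") (auto simp: y'_def a_def[symmetric] field_simps power2_eq_square)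
    also have "b * b / a = (\<Sum>i<n. \<Sum>j<n. A i n * A j n / a * y i * y j)"
      unfolding b_def sum_product sum_divide_distrib by (simp add: mult_ac)
    also have "(\<Sum>i<n. \<Sum>j<n. A i j * y i * y j) - \<dots> = (\<Sum>i<n. \<Sum>j<n. S i j * y i * y j)"
      by (simp add: S_def sum_subtractf[symmetric] algebra_simps)
    finally show "0 \<le> (\<Sum>i<n. \<Sum>j<n. S i j * y i * y j)" .
  qed
  from Suc.IH[OF this] obtain L d where
    Ld: "\<forall>k<n. L k k = 1 \<and> 0 \<le> d k" "\<forall>k i. k < i \<longrightarrow> L k i = 0"
      "\<forall>i<n. \<forall>j<n. S i j = (\<Sum>k<n. d k * L k i * L k j)"
    by blast
  \<comment> \<open>Pivots are taken from the last index downwards, so the new row \<open>n\<close>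
    is full and the earlier rows vanish in column \<open>n\<close>: the factor is lower
    triangular.\<close>
  define L' where "L' k i = (if k = n then if i = n then 1 else if i < n then A i n / a else 0 else L k i)" for k i
  define d' where "d' = d(n := a)"
  have S_eq: "(\<Sum>k<n. d' k * L' k i * L' k j) = (\<Sum>k<n. d k * L k i * L k j)" for i j
    by (intro sum.cong refl) (auto simp: d'_def L'_def)
  have "A i j = (\<Sum>k<Suc n. d' k * L' k i * L' k j)" if "i < Suc n" "j < Suc n" for i j
  proof -
    have zn: "(\<Sum>k<n. d k * L k i * L k j) = 0" if "i \<ge> n \<or> j \<ge> n" for i j
      using Ld(2) that by (intro sum.neutral) fastforce
    consider "i < n" "j < n" | "i = n" "j = n" | "i < n" "j = n" | "i = n" "j < n"
      using \<open>i < Suc n\<close> \<open>j < Suc n\<close> by linarith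
    then show ?thesis
    proof cases
      case 1
      then have "A i j = S i j + a * (A i n / a) * (A j n / a)" by (simp add: S_def)
      with 1 Ld(3) show ?thesis by (simp add: S_eq) (simp add: d'_def L'_def)
    next
      case 2
      then show ?thesis by (simp add: S_eq zn) (simp add: d'_def L'_def a_def)
    next
      case 3
      with z show ?thesis by (simp add: S_eq zn) (auto simp: d'_def L'_def)
    next
      case 4
      with z sym[of n j] show ?thesis by (simp add: S_eq zn) (auto simp: d'_def L'_def)
    qed
  qed
  moreover have "\<forall>k<Suc n. L' k k = 1 \<and> 0 \<le> d' k"
    using Ld(1) a by (auto simp: L'_def d'_def less_Suc_eq)
  moreover have "\<forall>k i. k < i \<longrightarrow> L' k i = 0"
    using Ld(2) by (auto simp: L'_def)
  ultimately show ?case by blast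
qed

lemma fmat_congruent:
  "fmat n (congruent_form n R A) = transpose_mat (fmat n R) * fmat n A * fmat n R"
proof (rule eq_matI)
  fix i j
  assume "i < dim_row (transpose_mat (fmat n R) * fmat n A * fmat n R)"
    "j < dim_col (transpose_mat (fmat n R) * fmat n A * fmat n R)"
  then have ij: "i < n" "j < n" by simp_all
  have "(transpose_mat (fmat n R) * fmat n A * fmat n R) $$ (i, j)
      = (\<Sum>b<n. (\<Sum>a<n. R a i * A a b) * R b j)"
    using ij by (simp add: scalar_prod_def lessThan_atLeast0)
  also have "\<dots> = (\<Sum>b<n. \<Sum>a<n. A a b * R a i * R b j)"
    unfolding sum_distrib_right by (intro sum.cong refl) (simp add: mult_ac)
  also have "\<dots> = congruent_form n R A i j"
    unfolding congruent_form_def by (rule sum.swap)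
  finally show "fmat n (congruent_form n R A) $$ (i, j)
      = (transpose_mat (fmat n R) * fmat n A * fmat n R) $$ (i, j)"
    using ij by simp
qed simp_all

lemma det_congruent_form:
  "det (fmat n (congruent_form n R A)) = (det (fmat n R))\<^sup>2 * det (fmat n A)"
proof -
  have R: "fmat n R \<in> carrier_mat n n" and A: "fmat n A \<in> carrier_mat n n" by simp_all
  have T: "transpose_mat (fmat n R) \<in> carrier_mat n n" by simp
  show ?thesis
    unfolding fmat_congruent det_mult[OF mult_carrier_mat[OF T A] R] det_mult[OF T A]
      det_transpose[OF R] by (simp add: power2_eq_square)
qed

lemma det_diagonal: "det (fmat n (\<lambda>i j. if i = j then d i else 0)) = (\<Prod>i<n. d i)"
proof -
  have "det (fmat n (\<lambda>i j. if i = j then d i else 0))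
      = prod_list (diag_mat (fmat n (\<lambda>i j. if i = j then d i else 0)))"
    by (rule det_upper_triangular[of _ n]) (auto simp: upper_triangular_def)
  also have "\<dots> = (\<Prod>i<n. d i)"
    by (simp add: prod_list_diag_prod lessThan_atLeast0)
  finally show ?thesis .
qed

lemma det_unit_lower_triangular:
  assumes "\<And>k. k < n \<Longrightarrow> L k k = 1" "\<And>k i. k < i \<Longrightarrow> L k i = 0"
  shows "det (fmat n L) = 1"
proof -
  have "det (fmat n L) = prod_list (diag_mat (fmat n L))"
    using assms(2) by (intro det_lower_triangular[of n]) auto
  also have "\<dots> = 1"
    using assms(1) by (simp add: prod_list_diag_prod)
  finally show ?thesis .
qed

lemma congruent_form_diagonal:
  "congruent_form n L (\<lambda>i j. if i = j then d i else 0) i j = (\<Sum>k<n. d k * L k i * L k j)"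
  unfolding congruent_form_def
proof (intro sum.cong refl)
  fix a assume "a \<in> {..<n}"
  have "(\<Sum>b<n. (if a = b then d a else 0) * L a i * L b j)
      = (\<Sum>b<n. if a = b then d a * L a i * L b j else 0)"
    by (intro sum.cong refl) auto
  also have "\<dots> = d a * L a i * L a j" using \<open>a \<in> {..<n}\<close> by simp
  finally show "(\<Sum>b<n. (if a = b then d a else 0) * L a i * L b j) = d a * L a i * L a j" .
qed

lemma psd_det_ldl:
  assumes "psd n A"
  shows "\<exists>L d. det (fmat n L) = 1 \<and> (\<forall>k<n. L k k = 1 \<and> 0 \<le> d k) \<and>
    (\<forall>i<n. \<forall>j<n. A i j = congruent_form n L (\<lambda>i j. if i = j then d i else 0) i j) \<and>
    det (fmat n A) = (\<Prod>k<n. d k)"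
proof -
  from psd_ldl[OF assms] obtain L d where
    Ld: "\<forall>k<n. L k k = 1 \<and> 0 \<le> d k" "\<forall>k i. k < i \<longrightarrow> L k i = 0"
      "\<forall>i<n. \<forall>j<n. A i j = (\<Sum>k<n. d k * L k i * L k j)"
    by blast
  have detL: "det (fmat n L) = 1"
    using Ld by (intro det_unit_lower_triangular) auto
  have cong: "congruent_form n L (\<lambda>i j. if i = j then d i else 0) i j = (\<Sum>k<n. d k * L k i * L k j)" for i j
    by (rule congruent_form_diagonal)
  have A: "A i j = congruent_form n L (\<lambda>i j. if i = j then d i else 0) i j" if "i < n" "j < n" for i j
    using Ld(3) that cong by simp
  have "fmat n A = fmat n (congruent_form n L (\<lambda>i j. if i = j then d i else 0))"
    by (rule eq_matI) (auto simp: A)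
  then have det: "det (fmat n A) = (\<Prod>k<n. d k)"
    by (simp add: det_congruent_form detL det_diagonal)
  show ?thesis
    by (intro exI[of _ L] exI[of _ d] conjI detL det Ld(1)) (simp add: A)
qed

lemma psd_det_nonneg: "psd n A \<Longrightarrow> 0 \<le> det (fmat n A)"
  using psd_det_ldl[of n A] by (metis lessThan_iff prod_nonneg)

text \<open>The factorisation makes \<open>A i i\<close> a sum of nonnegative terms, one of which is
  the pivot \<open>d i\<close>, while the determinant is the product of the pivots.\<close>

lemma hadamard_inequality:
  assumes "psd n A"
  shows "det (fmat n A) \<le> (\<Prod>i<n. A i i)"
proof -
  obtain L d where "\<forall>k<n. L k k = 1 \<and> 0 \<le> d k"
    and A: "\<forall>i<n. \<forall>j<n. A i j = congruent_form n L (\<lambda>i j. if i = j then d i else 0) i j"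
    and det: "det (fmat n A) = (\<Prod>k<n. d k)"
    using psd_det_ldl[OF assms] by blast
  then have d: "0 \<le> d k" and L: "L k k = 1" if "k < n" for k
    using that by blast+
  have "d i \<le> A i i" if "i < n" for i
  proof -
    have "A i i = (\<Sum>k<n. d k * L k i * L k i)"
      by (rule trans[OF A[rule_format, OF that that] congruent_form_diagonal])
    also have "\<dots> \<ge> d i * L i i * L i i"
      by (rule member_le_sum) (use d that in \<open>auto simp: mult.assoc\<close>)
    finally show ?thesis using L that by simp
  qed
  with d det show ?thesis by (auto intro: prod_mono)
qed

lemma quadratic_form_congruent:
  "(\<Sum>i<n. \<Sum>j<n. congruent_form n R A i j * y i * y j)
    = (\<Sum>a<n. \<Sum>b<n. A a b * (\<Sum>i<n. R a i * y i) * (\<Sum>j<n. R b j * y j))"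
proof -
  have "(\<Sum>i<n. \<Sum>j<n. congruent_form n R A i j * y i * y j)
      = (\<Sum>i<n. \<Sum>j<n. \<Sum>a<n. \<Sum>b<n. A a b * (R a i * y i) * (R b j * y j))"
    unfolding congruent_form_def sum_distrib_right
    by (intro sum.cong refl) (simp add: mult_ac)
  also have "\<dots> = (\<Sum>i<n. \<Sum>a<n. \<Sum>j<n. \<Sum>b<n. A a b * (R a i * y i) * (R b j * y j))"
    by (intro sum.cong refl sum.swap)
  also have "\<dots> = (\<Sum>i<n. \<Sum>a<n. \<Sum>b<n. \<Sum>j<n. A a b * (R a i * y i) * (R b j * y j))"
    by (intro sum.cong refl sum.swap)
  also have "\<dots> = (\<Sum>a<n. \<Sum>i<n. \<Sum>b<n. \<Sum>j<n. A a b * (R a i * y i) * (R b j * y j))"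
    by (rule sum.swap)
  also have "\<dots> = (\<Sum>a<n. \<Sum>b<n. \<Sum>i<n. \<Sum>j<n. A a b * (R a i * y i) * (R b j * y j))"
    by (intro sum.cong refl sum.swap)
  also have "\<dots> = (\<Sum>a<n. \<Sum>b<n. A a b * (\<Sum>i<n. R a i * y i) * (\<Sum>j<n. R b j * y j))"
    unfolding mult.assoc sum_product unfolding sum_distrib_left ..
  finally show ?thesis .
qed

lemma psd_congruent_form:
  assumes "psd n A"
  shows "psd n (congruent_form n R A)"
proof -
  have sym: "congruent_form n R A i j = congruent_form n R A j i" for i j
  proof -
    have "congruent_form n R A i j = (\<Sum>b<n. \<Sum>a<n. A a b * R a i * R b j)"
      unfolding congruent_form_def by (rule sum.swap)
    also have "\<dots> = congruent_form n R A j i"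
      unfolding congruent_form_def
      using assms by (intro sum.cong refl) (simp add: psd_def mult_ac)
    finally show ?thesis .
  qed
  show ?thesis
    unfolding psd_def quadratic_form_congruent
  proof (intro conjI allI impI sym)
    show "0 \<le> (\<Sum>a<n. \<Sum>b<n. A a b * (\<Sum>i<n. R a i * y i) * (\<Sum>j<n. R b j * y j))" for y
      using assms by (rule psd_form)
  qed
qed

lemma congruent_form_sum:
  "congruent_form n R (\<lambda>a b. \<Sum>j\<in>J. l j * A j a b) i k = (\<Sum>j\<in>J. l j * congruent_form n R (A j) i k)"
proof -
  have "congruent_form n R (\<lambda>a b. \<Sum>j\<in>J. l j * A j a b) i k
      = (\<Sum>a<n. \<Sum>b<n. \<Sum>j\<in>J. l j * (A j a b * R a i * R b k))"
    unfolding congruent_form_def sum_distrib_right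
    by (intro sum.cong refl) (simp add: mult_ac)
  also have "\<dots> = (\<Sum>a<n. \<Sum>j\<in>J. \<Sum>b<n. l j * (A j a b * R a i * R b k))"
    by (intro sum.cong refl sum.swap)
  also have "\<dots> = (\<Sum>j\<in>J. \<Sum>a<n. \<Sum>b<n. l j * (A j a b * R a i * R b k))"
    by (rule sum.swap)
  finally show ?thesis
    by (simp add: congruent_form_def sum_distrib_left)
qed

lemma psd_sum:
  assumes "\<And>j. j \<in> J \<Longrightarrow> psd n (A j)" "\<And>j. j \<in> J \<Longrightarrow> 0 \<le> l j"
  shows "psd n (\<lambda>a b. \<Sum>j\<in>J. l j * A j a b)"
  unfolding psd_def
proof (intro conjI allI impI)
  show "(\<Sum>j\<in>J. l j * A j a b) = (\<Sum>j\<in>J. l j * A j b a)" if "a < n" "b < n" for a b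
    using assms(1) that by (intro sum.cong refl) (simp add: psd_def)
  fix y :: "nat \<Rightarrow> real"
  have "(\<Sum>a<n. \<Sum>b<n. (\<Sum>j\<in>J. l j * A j a b) * y a * y b)
      = (\<Sum>a<n. \<Sum>b<n. \<Sum>j\<in>J. l j * (A j a b * y a * y b))"
    unfolding sum_distrib_right by (intro sum.cong refl) (simp add: mult_ac)
  also have "\<dots> = (\<Sum>a<n. \<Sum>j\<in>J. \<Sum>b<n. l j * (A j a b * y a * y b))"
    by (intro sum.cong refl sum.swap)
  also have "\<dots> = (\<Sum>j\<in>J. l j * (\<Sum>a<n. \<Sum>b<n. A j a b * y a * y b))"
    by (rule trans[OF sum.swap]) (simp add: sum_distrib_left)
  also have "\<dots> \<ge> 0"
    by (intro sum_nonneg mult_nonneg_nonneg assms(2) psd_form[OF assms(1)])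
  finally show "0 \<le> (\<Sum>a<n. \<Sum>b<n. (\<Sum>j\<in>J. l j * A j a b) * y a * y b)" .
qed

text \<open>The diagonal case of quasi-concavity, from the concavity of \<open>ln\<close>. The
  positive threshold \<open>c\<close> forces every factor to be positive, so that all logarithms
  make sense.\<close>

lemma prod_convex_combination_ge:
  fixes \<alpha> :: "'j \<Rightarrow> nat \<Rightarrow> real"
  assumes "finite J" "\<And>j. j \<in> J \<Longrightarrow> 0 \<le> l j" "(\<Sum>j\<in>J. l j) = 1"
    and \<alpha>: "\<And>j i. j \<in> J \<Longrightarrow> i < n \<Longrightarrow> 0 \<le> \<alpha> j i"
    and c: "0 < c" "\<And>j. j \<in> J \<Longrightarrow> c \<le> (\<Prod>i<n. \<alpha> j i)"
  shows "c \<le> (\<Prod>i<n. \<Sum>j\<in>J. l j * \<alpha> j i)"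
proof -
  define d where "d i = (\<Sum>j\<in>J. l j * \<alpha> j i)" for i
  have pos: "0 < \<alpha> j i" if "j \<in> J" "i < n" for i j
  proof -
    have "(\<Prod>i<n. \<alpha> j i) \<noteq> 0" using c(1) c(2)[OF that(1)] by linarith
    then have "\<alpha> j i \<noteq> 0" using that(2) by auto
    with \<alpha>[OF that] show ?thesis by simp
  qed
  obtain j0 where j0: "j0 \<in> J" "l j0 > 0"
  proof (rule ccontr)
    assume "\<not> thesis"
    then have "l j = 0" if "j \<in> J" for j
      using \<open>\<And>j0. j0 \<in> J \<Longrightarrow> 0 < l j0 \<Longrightarrow> thesis\<close> that assms(2)[OF that] by fastforce
    then show False using assms(3) by simp
  qed
  have d: "0 < d i" if "i < n" for i
    unfolding d_def
    by (rule sum_pos2[OF assms(1) j0(1)]) (use j0 pos[OF _ that] assms(2) that \<alpha> in auto)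
  have "ln c = (\<Sum>j\<in>J. l j * ln c)"
    by (simp add: sum_distrib_right[symmetric] assms(3))
  also have "\<dots> \<le> (\<Sum>j\<in>J. l j * (\<Sum>i<n. ln (\<alpha> j i)))"
  proof (intro sum_mono mult_left_mono)
    fix j assume j: "j \<in> J"
    have "ln c \<le> ln (\<Prod>i<n. \<alpha> j i)" using c(1) c(2)[OF j] by simp
    also have "\<dots> = (\<Sum>i<n. ln (\<alpha> j i))"
      using pos j by (intro ln_prod) (auto simp: less_imp_neq[symmetric])
    finally show "ln c \<le> (\<Sum>i<n. ln (\<alpha> j i))" .
  qed (use assms in auto)
  \<comment> \<open>The graph of \<open>ln\<close> lies below its tangent at the weighted mean
    \<open>d i\<close>; the linear corrections then average to zero over \<open>J\<close>.\<close>
  also have "\<dots> \<le> (\<Sum>j\<in>J. l j * (\<Sum>i<n. ln (d i) + (\<alpha> j i / d i - 1)))"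
  proof (intro sum_mono mult_left_mono)
    fix j i assume j: "j \<in> J" "i \<in> {..<n}"
    then have "ln (\<alpha> j i / d i) \<le> \<alpha> j i / d i - 1"
      using pos d by (intro ln_le_minus_one) auto
    then show "ln (\<alpha> j i) \<le> ln (d i) + (\<alpha> j i / d i - 1)"
      using j pos[of j i] d[of i] by (simp add: ln_div)
  qed (use assms in auto)
  also have "\<dots> = (\<Sum>i<n. \<Sum>j\<in>J. l j * ln (d i) + (l j * \<alpha> j i / d i - l j))"
    unfolding sum_distrib_left by (rule trans[OF sum.swap]) (simp add: algebra_simps)
  also have "\<dots> = (\<Sum>i<n. ln (d i))"
  proof (intro sum.cong refl)
    fix i assume "i \<in> {..<n}"
    then have "(\<Sum>j\<in>J. l j * \<alpha> j i / d i) = 1"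
      using d[of i] by (simp add: sum_divide_distrib[symmetric] d_def)
    then show "(\<Sum>j\<in>J. l j * ln (d i) + (l j * \<alpha> j i / d i - l j)) = ln (d i)"
      by (simp add: sum.distrib sum_subtractf sum_distrib_right[symmetric] assms(3))
  qed
  also have "\<dots> = ln (\<Prod>i<n. d i)"
    using d by (intro ln_prod[symmetric]) (auto simp: less_imp_neq[symmetric])
  finally show ?thesis
    using c(1) d by (subst (asm) ln_le_cancel_iff) (auto simp: d_def intro!: prod_pos)
qed

text \<open>
  In coordinates diagonalising the combination, its determinant is the product of its diagonal
  entries, while Hadamard bounds the determinants of the summands by theirs.
\<close>

lemma det_convex_combination_ge:
  assumes J: "finite J" "\<And>j. j \<in> J \<Longrightarrow> 0 \<le> l j" "(\<Sum>j\<in>J. l j) = 1"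
    and A: "\<And>j. j \<in> J \<Longrightarrow> psd n (A j)"
    and c: "0 < c" "\<And>j. j \<in> J \<Longrightarrow> c \<le> det (fmat n (A j))"
  shows "c \<le> det (fmat n (\<lambda>a b. \<Sum>j\<in>J. l j * A j a b))"
proof -
  define N where "N = (\<lambda>a b. \<Sum>j\<in>J. l j * A j a b)"
  have "psd n N" unfolding N_def using A J by (intro psd_sum) auto
  then obtain L d where L: "det (fmat n L) = 1"
    and N: "\<forall>i<n. \<forall>j<n. N i j = congruent_form n L (\<lambda>i j. if i = j then d i else 0) i j"
    and detN: "det (fmat n N) = (\<Prod>k<n. d k)"
    using psd_det_ldl[of n N] by blast
  define D where "D = fmat n (\<lambda>i j. if i = j then d i else 0)"
  \<comment> \<open>The inverse of the triangular factor gives a congruence of determinant one that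
    carries \<open>N\<close> to its diagonal matrix of pivots and leaves the determinants of all
    summands unchanged.\<close>
  have "fmat n L \<in> Units (ring_mat TYPE(real) n ())"
    using L by (intro det_non_zero_imp_unit) auto
  then obtain R' where R': "R' \<in> carrier_mat n n" "fmat n L * R' = 1\<^sub>m n"
    by (auto simp: Units_def ring_mat_def)
  define R where "R i j = R' $$ (i, j)" for i j
  have R: "fmat n R = R'"
    using R'(1) by (intro eq_matI) (auto simp: R_def)
  have detR: "det (fmat n R) = 1"
    using arg_cong[OF R'(2), of det] R'(1) L by (simp add: R det_mult[of _ n])
  have Lc: "fmat n L \<in> carrier_mat n n" and Dc: "D \<in> carrier_mat n n" by (simp_all add: D_def)
  have NN: "fmat n N = transpose_mat (fmat n L) * D * fmat n L"
    unfolding D_def fmat_congruent[symmetric] by (rule eq_matI) (auto simp: N)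
  have "fmat n (congruent_form n R N)
      = transpose_mat R' * (transpose_mat (fmat n L) * D * fmat n L) * R'"
    by (simp add: fmat_congruent NN R)
  also have "\<dots> = (transpose_mat R' * transpose_mat (fmat n L)) * D * (fmat n L * R')"
    using R'(1) Lc Dc by (simp add: assoc_mult_mat[of _ n n _ n _ n] mult_carrier_mat[of _ n n _ n])
  also have "transpose_mat R' * transpose_mat (fmat n L) = 1\<^sub>m n"
    using transpose_mult[OF Lc R'(1)] R'(2) by simp
  finally have RNR: "fmat n (congruent_form n R N) = D"
    using R'(2) Dc by simp
  have diag: "(\<Sum>j\<in>J. l j * congruent_form n R (A j) i i) = d i" if "i < n" for i
    using arg_cong[OF RNR, of "\<lambda>M. M $$ (i, i)"] that
    by (simp add: D_def N_def congruent_form_sum)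
  have "c \<le> (\<Prod>i<n. \<Sum>j\<in>J. l j * congruent_form n R (A j) i i)"
  proof (rule prod_convex_combination_ge[OF J _ c(1)])
    fix j assume j: "j \<in> J"
    have psd: "psd n (congruent_form n R (A j))" using A[OF j] by (rule psd_congruent_form)
    show "0 \<le> congruent_form n R (A j) i i" if "i < n" for i
      by (rule psd_diag[OF psd that])
    have "c \<le> det (fmat n (congruent_form n R (A j)))"
      using c(2)[OF j] by (simp add: det_congruent_form detR)
    also have "\<dots> \<le> (\<Prod>i<n. congruent_form n R (A j) i i)"
      by (rule hadamard_inequality[OF psd])
    finally show "c \<le> (\<Prod>i<n. congruent_form n R (A j) i i)" .
  qed
  also have "\<dots> = det (fmat n N)" by (simp add: detN diag)
  finally show ?thesis by (simp add: N_def)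
qed

text \<open>The signed permutation matrix \<open>R\<close> fixes the identity under congruence, so
  its determinant squares to 1 and the sign of the permutation never has to be found.\<close>

lemma det_signed_permutation:
  assumes "\<And>i. i < n \<Longrightarrow> \<sigma> i < n" "inj_on \<sigma> {..<n}" "\<And>i. i < n \<Longrightarrow> e i * e i = (1::real)"
  shows "det (fmat n (\<lambda>i j. e i * e j * A (\<sigma> i) (\<sigma> j))) = det (fmat n A)"
proof -
  define R where "R a i = (if a = \<sigma> i then e i else 0)" for a i
  have cong: "congruent_form n R B i j = e i * e j * B (\<sigma> i) (\<sigma> j)" if "i < n" "j < n" for B i j
    unfolding congruent_form_def R_def double_sum_mult_delta[OF assms(1)[OF that(1)] assms(1)[OF that(2)]]
    by simp
  have "fmat n (congruent_form n R (\<lambda>i j. if i = j then 1 else 0)) = fmat n (\<lambda>i j. if i = j then 1 else 0)"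
    by (rule eq_matI) (use assms in \<open>auto simp: cong inj_on_def\<close>)
  from arg_cong[OF this, of det] have "(det (fmat n R))\<^sup>2 = 1"
    by (simp add: det_congruent_form det_diagonal)
  moreover have "fmat n (\<lambda>i j. e i * e j * A (\<sigma> i) (\<sigma> j)) = fmat n (congruent_form n R A)"
    by (rule eq_matI) (auto simp: cong)
  ultimately show ?thesis by (simp add: det_congruent_form)
qed

section \<open>Moments of invariant designs\<close>

definition chi :: "nat set \<Rightarrow> real vec \<Rightarrow> real" where
  "chi S x = (\<Prod>i\<in>S. x $ i)"

definition small_subsets :: "nat \<Rightarrow> nat set list" where
  "small_subsets K = [{}] @ [{k}. k \<leftarrow> [0..<K]] @ [{j, k}. j \<leftarrow> [0..<K], k \<leftarrow> [Suc j..<K]]"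

lemma regressors_eq_chi: "regressors K x = vec_of_list (map (\<lambda>S. chi S x) (small_subsets K))"
proof -
  have inner: "map (\<lambda>k. x $ j * x $ k) [Suc j..<K] = map (\<lambda>k. chi {j, k} x) [Suc j..<K]" for j
    by (intro map_cong refl) (auto simp: chi_def)
  have triv: "chi {} x = 1" "chi {k} x = x $ k" for k
    by (simp_all add: chi_def)
  show ?thesis
    unfolding regressors_def small_subsets_def inner
    by (simp add: map_concat comp_def triv)
qed

lemma length_small_subsets: "length (small_subsets K) = num_params K"
  using dim_regressors[of K] by (simp add: regressors_eq_chi)

lemma set_small_subsets: "set (small_subsets K) = {S. S \<subseteq> {..<K} \<and> card S \<le> 2}" (is "_ = ?R")
proof (intro subset_antisym subsetI)
  show "S \<in> ?R" if "S \<in> set (small_subsets K)" for S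
    using that by (auto simp: small_subsets_def)
  fix S assume S: "S \<in> ?R"
  then have fin: "finite S" using finite_subset by blast
  consider "card S = 0" | "card S = 1" | "card S = 2" using S by fastforce
  then show "S \<in> set (small_subsets K)"
  proof cases
    case 1
    with fin show ?thesis by (simp add: small_subsets_def)
  next
    case 2
    then obtain k where "S = {k}" by (rule card_1_singletonE)
    with S show ?thesis by (simp add: small_subsets_def image_iff)
  next
    case 3
    then obtain a b where ab: "S = {a, b}" "a \<noteq> b" by (auto simp: card_2_iff)
    have pair: "{j, k} \<in> set (small_subsets K)" if "j < k" "k < K" for j k
    proof -
      have "{j, k} \<in> (\<Union>j\<in>{..<K}. (\<lambda>k. {j, k}) ` {Suc j..<K})"
        using that by (intro UN_I[of j] image_eqI[of _ _ k]) auto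
      then show ?thesis by (simp add: small_subsets_def lessThan_atLeast0)
    qed
    show ?thesis
    proof (cases "a < b")
      case True
      with pair[of a b] ab S show ?thesis by simp
    next
      case False
      with pair[of b a] ab S show ?thesis by (simp add: insert_commute)
    qed
  qed
qed

text \<open>Since the list of subsets has exactly this length, it has no repetitions, and regressor
  indices correspond bijectively to subsets.\<close>

lemma card_small_subsets: "card {S. S \<subseteq> {..<K} \<and> card S \<le> 2} = num_params K"
proof -
  have fin: "finite {S. S \<subseteq> {..<K} \<and> card S = k}" for k
    by (rule finite_subset[of _ "Pow {..<K}"]) auto
  have "n \<le> 2 \<longleftrightarrow> n \<in> {0, 1, 2}" for n :: nat by auto
  then have eq: "{S. S \<subseteq> {..<K} \<and> card S \<le> 2} = (\<Union>k\<in>{0, 1, 2}. {S. S \<subseteq> {..<K} \<and> card S = k})"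
    by blast
  have "card {S. S \<subseteq> {..<K} \<and> card S \<le> 2} = (\<Sum>k\<in>{0, 1, 2}. card {S. S \<subseteq> {..<K} \<and> card S = k})"
    unfolding eq by (rule card_UN_disjoint) (use fin in auto)
  also have "\<dots> = 1 + K + K * (K - 1) div 2"
    by (simp add: n_subsets choose_two)
  also have "\<dots> = num_params K"
    by (cases K) (simp_all add: num_params_def algebra_simps)
  finally show ?thesis .
qed

text \<open>The set of coordinates whose product is the regressor with index
  \<open>r\<close>.\<close>

definition factor :: "nat \<Rightarrow> nat \<Rightarrow> nat set" where
  "factor K r = small_subsets K ! r"

lemma bij_betw_factor:
  "bij_betw (factor K) {..<num_params K} {S. S \<subseteq> {..<K} \<and> card S \<le> 2}"
proof -
  have "distinct (small_subsets K)"
    by (rule card_distinct) (simp add: set_small_subsets card_small_subsets length_small_subsets)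
  then show ?thesis
    unfolding factor_def by (rule bij_betw_nth) (simp_all add: length_small_subsets set_small_subsets)
qed

lemma factor_subset: "r < num_params K \<Longrightarrow> factor K r \<subseteq> {..<K}"
  and card_factor: "r < num_params K \<Longrightarrow> card (factor K r) \<le> 2"
  using bij_betwE[OF bij_betw_factor[of K]] by auto

lemma regressors_nth: "r < num_params K \<Longrightarrow> regressors K x $ r = chi (factor K r) x"
  by (simp add: regressors_eq_chi factor_def length_small_subsets vec_of_list_index)

section \<open>Integration against weights and the entries of the information matrix\<close>

definition integ :: "nat \<Rightarrow> (real vec \<Rightarrow> real) \<Rightarrow> (real vec \<Rightarrow> real) \<Rightarrow> real" where
  "integ K \<xi> h = (\<Sum>x\<in>cube K. \<xi> x * h x)"

definition info :: "nat \<Rightarrow> (real vec \<Rightarrow> real) \<Rightarrow> nat \<Rightarrow> nat \<Rightarrow> real" where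
  "info K \<xi> r s = integ K \<xi> (\<lambda>x. chi (factor K r) x * chi (factor K s) x)"

lemma information_matrix_eq: "information_matrix K \<xi> = fmat (num_params K) (info K \<xi>)"
  unfolding information_matrix_def
  by (rule cong_mat) (auto simp: info_def integ_def regressors_nth)

lemma info_sum: "info K (\<lambda>x. \<Sum>j\<in>J. l j * \<xi> j x) = (\<lambda>r s. \<Sum>j\<in>J. l j * info K (\<xi> j) r s)"
proof (intro ext)
  show "info K (\<lambda>x. \<Sum>j\<in>J. l j * \<xi> j x) r s = (\<Sum>j\<in>J. l j * info K (\<xi> j) r s)" for r s
    unfolding info_def integ_def sum_distrib_left sum_distrib_right mult.assoc by (rule sum.swap)
qed

text \<open>The quadratic form at \<open>y\<close> is the integral of the square of the regression
  function with coefficients \<open>y\<close>.\<close>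

lemma psd_info:
  assumes "\<And>x. x \<in> cube K \<Longrightarrow> 0 \<le> \<xi> x"
  shows "psd n (info K \<xi>)"
  unfolding psd_def
proof (intro conjI allI impI)
  show "info K \<xi> i j = info K \<xi> j i" for i j
    by (simp add: info_def mult.commute)
  fix y :: "nat \<Rightarrow> real"
  let ?c = "\<lambda>i x. chi (factor K i) x * y i"
  have "(\<Sum>i<n. \<Sum>j<n. info K \<xi> i j * y i * y j) = (\<Sum>i<n. \<Sum>j<n. \<Sum>x\<in>cube K. \<xi> x * (?c i x * ?c j x))"
    unfolding info_def integ_def sum_distrib_right by (intro sum.cong refl) (simp add: mult_ac)
  also have "\<dots> = (\<Sum>i<n. \<Sum>x\<in>cube K. \<Sum>j<n. \<xi> x * (?c i x * ?c j x))"
    by (intro sum.cong refl sum.swap)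
  also have "\<dots> = (\<Sum>x\<in>cube K. \<Sum>i<n. \<Sum>j<n. \<xi> x * (?c i x * ?c j x))"
    by (rule sum.swap)
  also have "\<dots> = (\<Sum>x\<in>cube K. \<xi> x * ((\<Sum>i<n. ?c i x) * (\<Sum>j<n. ?c j x)))"
    unfolding sum_product unfolding sum_distrib_left ..
  also have "\<dots> \<ge> 0"
    using assms by (intro sum_nonneg mult_nonneg_nonneg zero_le_square)
  finally show "0 \<le> (\<Sum>i<n. \<Sum>j<n. info K \<xi> i j * y i * y j)" .
qed

lemma cube_nth: "x \<in> cube K \<Longrightarrow> i < K \<Longrightarrow> x $ i * x $ i = 1"
  by (auto simp: cube_def)

lemma dim_vec_cube: "x \<in> cube K \<Longrightarrow> dim_vec x = K"
  by (auto simp: cube_def)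

lemma finite_cube: "finite (cube K)"
proof (rule finite_subset)
  show "cube K \<subseteq> vec_of_list ` {xs. set xs \<subseteq> {-1, 1} \<and> length xs = K}"
  proof
    fix x assume x: "x \<in> cube K"
    then have "set (list_of_vec x) \<subseteq> {-1, 1}"
      by (auto simp: cube_def in_set_conv_nth list_of_vec_index)
    moreover have "length (list_of_vec x) = K" using x by (simp add: dim_vec_cube)
    ultimately show "x \<in> vec_of_list ` {xs. set xs \<subseteq> {-1, 1} \<and> length xs = K}"
      by (intro image_eqI[of _ _ "list_of_vec x"]) (auto simp: vec_list)
  qed
qed (simp add: finite_lists_length_eq)

lemma chi_square:
  assumes "x \<in> cube K" "S \<subseteq> {..<K}"
  shows "chi S x * chi S x = 1"
  unfolding chi_def prod.distrib[symmetric] using assms cube_nth by (intro prod.neutral) auto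

text \<open>Coordinates in \<open>S \<inter> T\<close> occur squared, and squares are 1 on the cube;
  only the symmetric difference survives.\<close>

lemma chi_mult:
  assumes x: "x \<in> cube K" and ST: "S \<subseteq> {..<K}" "T \<subseteq> {..<K}"
  shows "chi S x * chi T x = chi ((S - T) \<union> (T - S)) x"
proof -
  have fin: "finite S" "finite T" using ST finite_subset by auto
  have S: "chi S x = chi (S - T) x * chi (S \<inter> T) x"
    using fin unfolding chi_def by (subst prod.union_disjoint[symmetric]) (auto intro!: prod.cong)
  have T: "chi T x = chi (T - S) x * chi (S \<inter> T) x"
    using fin unfolding chi_def by (subst prod.union_disjoint[symmetric]) (auto intro!: prod.cong)
  have U: "chi ((S - T) \<union> (T - S)) x = chi (S - T) x * chi (T - S) x"
    using fin unfolding chi_def by (intro prod.union_disjoint) auto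
  have "chi (S \<inter> T) x * chi (S \<inter> T) x = 1"
    using x by (rule chi_square) (use ST in auto)
  then show ?thesis unfolding S T U by (simp add: mult_ac)
qed

section \<open>Coordinate permutations and the global sign change\<close>

definition act :: "nat \<Rightarrow> (nat \<Rightarrow> nat) \<Rightarrow> real \<Rightarrow> real vec \<Rightarrow> real vec" where
  "act K p c x = vec K (\<lambda>i. c * x $ p i)"

abbreviation signed_perms :: "nat \<Rightarrow> ((nat \<Rightarrow> nat) \<times> real) set" where
  "signed_perms K \<equiv> {p. p permutes {..<K}} \<times> {-1, 1}"

lemma permutes_less: "p permutes {..<K} \<Longrightarrow> i < K \<Longrightarrow> p i < (K::nat)"
  using permutes_in_image[of p "{..<K}" i] by simp

lemma act_in_cube:
  assumes "p permutes {..<K}" "c \<in> {-1, 1}" "x \<in> cube K"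
  shows "act K p c x \<in> cube K"
  using assms permutes_less[OF assms(1)] by (fastforce simp: act_def cube_def)

lemma act_act:
  assumes "p permutes {..<K}"
  shows "act K p c (act K q d x) = act K (q \<circ> p) (d * c) x"
  using permutes_less[OF assms] by (auto simp: act_def)

lemma act_id: "x \<in> cube K \<Longrightarrow> act K id 1 x = x"
  by (auto simp: act_def cube_def)

lemma act_inverse:
  assumes "p permutes {..<K}" "c \<in> {-1, 1}" "x \<in> cube K"
  shows "act K (inv_into UNIV p) c (act K p c x) = x" "act K p c (act K (inv_into UNIV p) c x) = x"
proof -
  have "c * c = 1" using assms(2) by auto
  then show "act K (inv_into UNIV p) c (act K p c x) = x" "act K p c (act K (inv_into UNIV p) c x) = x"
    by (simp_all only: act_act[OF permutes_inv[OF assms(1)]] act_act[OF assms(1)]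
        permutes_inv_o[OF assms(1)] act_id[OF assms(3)])
qed

lemma sum_act:
  assumes "p permutes {..<K}" "c \<in> {-1, 1}"
  shows "(\<Sum>x\<in>cube K. f (act K p c x)) = (\<Sum>x\<in>cube K. f x)"
  by (rule sum.reindex_bij_witness[of _ "act K (inv_into UNIV p) c" "act K p c"])
    (simp_all add: act_inverse[OF assms] act_in_cube[OF assms]
      act_in_cube[OF permutes_inv[OF assms(1)] assms(2)])

lemma chi_act:
  assumes "p permutes {..<K}" "S \<subseteq> {..<K}"
  shows "chi S (act K p c x) = c ^ card S * chi (p ` S) x"
proof -
  have "chi S (act K p c x) = (\<Prod>i\<in>S. c * x $ p i)"
    unfolding chi_def act_def using assms(2) by (intro prod.cong) auto
  also have "\<dots> = c ^ card S * chi (p ` S) x"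
    unfolding chi_def using permutes_inj_on[OF assms(1)] by (simp add: prod.distrib prod.reindex)
  finally show ?thesis .
qed

section \<open>Elementary symmetric polynomials in the coordinates of a cube point\<close>

definition esum :: "nat set \<Rightarrow> nat \<Rightarrow> real vec \<Rightarrow> real" where
  "esum I k x = (\<Sum>S | S \<subseteq> I \<and> card S = k. chi S x)"

lemma esum_0: "finite I \<Longrightarrow> esum I 0 x = 1"
proof -
  assume fin: "finite I"
  have "S = {}" if "S \<subseteq> I" "card S = 0" for S
    using finite_subset[OF that(1) fin] that(2) by simp
  then have "{S. S \<subseteq> I \<and> card S = 0} = {{}}" by auto
  then show ?thesis by (simp add: esum_def chi_def)
qed

lemma esum_empty: "esum {} (Suc k) x = 0"
  unfolding esum_def by (rule sum.neutral) auto

lemma esum_insert: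
  assumes "finite I" "a \<notin> I"
  shows "esum (insert a I) (Suc k) x = esum I (Suc k) x + x $ a * esum I k x"
proof -
  have fin: "finite {S. S \<subseteq> I \<and> card S = m}" for m
    by (rule finite_subset[of _ "Pow I"]) (use assms(1) in auto)
  have fS: "finite S" if "S \<subseteq> I" for S using that assms(1) by (rule finite_subset)
  have "{S. S \<subseteq> insert a I \<and> card S = Suc k}
      = {S. S \<subseteq> I \<and> card S = Suc k} \<union> insert a ` {S. S \<subseteq> I \<and> card S = k}" (is "?L = ?R")
  proof (intro subset_antisym subsetI)
    fix S assume S: "S \<in> ?L"
    show "S \<in> ?R"
    proof (cases "a \<in> S")
      case True
      have "S - {a} \<subseteq> I" using S by blast
      moreover have "card (S - {a}) = k" using S True by simp
      moreover have "S = insert a (S - {a})" using True by (simp add: insert_absorb)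
      ultimately show ?thesis by blast
    next
      case False
      with S show ?thesis by blast
    qed
  next
    fix S assume "S \<in> ?R"
    then consider "S \<subseteq> I" "card S = Suc k" | R where "S = insert a R" "R \<subseteq> I" "card R = k"
      by blast
    then show "S \<in> ?L"
    proof cases
      case 1
      then show ?thesis by blast
    next
      case 2
      have "a \<notin> R" using 2 assms(2) by blast
      with 2 fS[of R] show ?thesis by auto
    qed
  qed
  then have "esum (insert a I) (Suc k) x
      = esum I (Suc k) x + (\<Sum>S\<in>insert a ` {S. S \<subseteq> I \<and> card S = k}. chi S x)"
    unfolding esum_def using fin assms(2) by (simp only:) (rule sum.union_disjoint, auto)
  also have "(\<Sum>S\<in>insert a ` {S. S \<subseteq> I \<and> card S = k}. chi S x)
      = (\<Sum>S | S \<subseteq> I \<and> card S = k. chi (insert a S) x)"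
    using assms(2) by (intro sum.reindex_cong[of "insert a"]) (auto simp: inj_on_def)
  also have "\<dots> = (\<Sum>S | S \<subseteq> I \<and> card S = k. x $ a * chi S x)"
    unfolding chi_def using assms(2) fS by (intro sum.cong refl prod.insert) auto
  finally show ?thesis by (simp add: esum_def sum_distrib_left)
qed

text \<open>Newton's identities when every power sum is either the cardinality or the plain sum.\<close>

lemma esum_formulas:
  assumes "finite I" "\<And>i. i \<in> I \<Longrightarrow> x $ i \<in> {-1, 1}"
  defines "s \<equiv> \<Sum>i\<in>I. x $ i" and "n \<equiv> real (card I)"
  shows "esum I 1 x = s \<and> esum I 2 x = (s\<^sup>2 - n) / 2 \<and> esum I 3 x = (s ^ 3 - (3 * n - 2) * s) / 6 \<and>
    esum I 4 x = (s ^ 4 - (6 * n - 8) * s\<^sup>2 + 3 * n\<^sup>2 - 6 * n) / 24"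
  unfolding s_def n_def using assms(1,2)
proof (induction I rule: finite_induct)
  case empty
  show ?case
    using esum_empty[of 0 x] esum_empty[of 1 x] esum_empty[of 2 x] esum_empty[of 3 x]
    by (simp add: numeral_eq_Suc)
next
  case (insert a I)
  have "1 = Suc 0" "2 = Suc 1" "3 = Suc 2" "4 = Suc (3 :: nat)" by simp_all
  note ins = esum_insert[OF insert.hyps, of 0 x, folded this(1)] esum_insert[OF insert.hyps, of 1 x, folded this(2)]
    esum_insert[OF insert.hyps, of 2 x, folded this(3)] esum_insert[OF insert.hyps, of 3 x, folded this(4)]
  have IH: "esum I 1 x = (\<Sum>i\<in>I. x $ i)" "esum I 2 x = ((\<Sum>i\<in>I. x $ i)\<^sup>2 - real (card I)) / 2"
    "esum I 3 x = ((\<Sum>i\<in>I. x $ i) ^ 3 - (3 * real (card I) - 2) * (\<Sum>i\<in>I. x $ i)) / 6"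
    "esum I 4 x = ((\<Sum>i\<in>I. x $ i) ^ 4 - (6 * real (card I) - 8) * (\<Sum>i\<in>I. x $ i)\<^sup>2
      + 3 * (real (card I))\<^sup>2 - 6 * real (card I)) / 24"
    using insert.IH insert.prems by auto
  have "x $ a = -1 \<or> x $ a = 1" using insert.prems by auto
  then show ?case
    unfolding ins IH esum_0[OF insert.hyps(1)] sum.insert[OF insert.hyps] card_insert_disjoint[OF insert.hyps]
    by (elim disjE) (simp_all add: power2_eq_square power3_eq_cube power4_eq_xxxx field_simps)
qed

text \<open>The statistic \<open>T\<close> of the overview. Squaring removes the effect of the
  global sign change.\<close>

definition score2 :: "nat \<Rightarrow> real vec \<Rightarrow> real" where
  "score2 K x = (\<Sum>i<K. x $ i)\<^sup>2"

lemma esum_score2: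
  assumes "x \<in> cube K"
  shows "esum {..<K} 2 x = (score2 K x - real K) / 2"
    and "esum {..<K} 4 x = ((score2 K x)\<^sup>2 - (6 * real K - 8) * score2 K x + 3 * (real K)\<^sup>2 - 6 * real K) / 24"
proof -
  have pm: "x $ i \<in> {-1, 1}" if "i \<in> {..<K}" for i
    using assms that by (auto simp: cube_def)
  show "esum {..<K} 2 x = (score2 K x - real K) / 2"
    and "esum {..<K} 4 x = ((score2 K x)\<^sup>2 - (6 * real K - 8) * score2 K x + 3 * (real K)\<^sup>2 - 6 * real K) / 24"
    using esum_formulas[of "{..<K}" x, OF finite_lessThan pm]
    by (simp_all add: score2_def power_mult[symmetric])
qed

lemma sum_act_nth:
  assumes "p permutes {..<K}"
  shows "(\<Sum>i<K. act K p c x $ i) = c * (\<Sum>i<K. x $ i)"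
proof -
  have "(\<Sum>i<K. act K p c x $ i) = (\<Sum>i<K. c * x $ p i)"
    by (simp add: act_def)
  also have "\<dots> = c * (\<Sum>i<K. x $ i)"
    unfolding sum_distrib_left by (rule sum.permute[OF assms, symmetric, unfolded comp_def])
  finally show ?thesis .
qed

lemma score2_act:
  assumes "p permutes {..<K}" "c \<in> {-1, 1}"
  shows "score2 K (act K p c x) = score2 K x"
  using assms by (auto simp: score2_def sum_act_nth power_mult_distrib)

section \<open>Integrals of monomials under invariant weights\<close>

lemma integ_cong:
  "(\<And>x. x \<in> cube K \<Longrightarrow> \<xi> x * h x = \<eta> x * g x) \<Longrightarrow> integ K \<xi> h = integ K \<eta> g"
  unfolding integ_def by (rule sum.cong) auto

lemma integ_add: "integ K \<xi> (\<lambda>x. g x + h x) = integ K \<xi> g + integ K \<xi> h"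
  by (simp add: integ_def sum.distrib algebra_simps)

lemma integ_diff: "integ K \<xi> (\<lambda>x. g x - h x) = integ K \<xi> g - integ K \<xi> h"
  by (simp add: integ_def sum_subtractf algebra_simps)

lemma integ_cmult: "integ K \<xi> (\<lambda>x. c * h x) = c * integ K \<xi> h"
  by (simp add: integ_def sum_distrib_left algebra_simps)

lemma integ_const: "integ K \<xi> (\<lambda>x. c) = c * integ K \<xi> (\<lambda>_. 1)"
  using integ_cmult[of K \<xi> c "\<lambda>_. 1"] by simp

lemma integ_weights_add:
  "integ K (\<lambda>x. a * \<xi> x + b * \<eta> x) h = a * integ K \<xi> h + b * integ K \<eta> h"
  by (simp add: integ_def sum.distrib sum_distrib_left algebra_simps)

definition invariant :: "nat \<Rightarrow> (real vec \<Rightarrow> real) \<Rightarrow> bool" where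
  "invariant K \<xi> \<longleftrightarrow> (\<forall>p c x. p permutes {..<K} \<longrightarrow> c \<in> {-1, 1} \<longrightarrow> x \<in> cube K \<longrightarrow> \<xi> (act K p c x) = \<xi> x)"

lemma integ_invariant:
  assumes "invariant K \<xi>" "p permutes {..<K}" "c \<in> {-1, 1}"
  shows "integ K \<xi> (\<lambda>x. h (act K p c x)) = integ K \<xi> h"
proof -
  have "integ K \<xi> (\<lambda>x. h (act K p c x)) = (\<Sum>x\<in>cube K. \<xi> (act K p c x) * h (act K p c x))"
    unfolding integ_def using assms by (intro sum.cong refl) (auto simp: invariant_def)
  also have "\<dots> = integ K \<xi> h"
    unfolding integ_def by (rule sum_act[OF assms(2,3), of "\<lambda>x. \<xi> x * h x"])
  finally show ?thesis .
qed

text \<open>A bijection from \<open>D\<close> to \<open>D'\<close> is glued to one between the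
  complements, which have equal size as well.\<close>

lemma ex_permutes_image:
  assumes "finite A" "D \<subseteq> A" "D' \<subseteq> A" "card D = card D'"
  shows "\<exists>p. p permutes A \<and> p ` D = D'"
proof -
  have fin: "finite D" "finite D'" using assms finite_subset by auto
  obtain f where f: "bij_betw f D D'" using finite_same_card_bij[OF fin assms(4)] by blast
  have "card (A - D) = card (A - D')" using assms fin by (simp add: card_Diff_subset)
  then obtain g where g: "bij_betw g (A - D) (A - D')"
    using finite_same_card_bij[of "A - D" "A - D'"] assms(1) by auto
  define p where "p i = (if i \<in> D then f i else if i \<in> A then g i else i)" for i
  have 1: "bij_betw p D D'" using f by (rule bij_betw_cong[THEN iffD1, rotated]) (simp add: p_def)
  have 2: "bij_betw p (A - D) (A - D')"
    using g by (rule bij_betw_cong[THEN iffD1, rotated]) (simp add: p_def)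
  have "bij_betw p (D \<union> (A - D)) (D' \<union> (A - D'))"
    using 1 2 by (rule bij_betw_combine) auto
  then have "bij_betw p A A" using assms(2,3) by (simp add: Un_absorb1)
  then have "p permutes A" using assms(2) by (intro bij_imp_permutes) (auto simp: p_def)
  with 1 show ?thesis by (auto simp: bij_betw_def)
qed

lemma integ_chi_card:
  assumes "invariant K \<xi>" "D \<subseteq> {..<K}" "D' \<subseteq> {..<K}" "card D = card D'"
  shows "integ K \<xi> (chi D) = integ K \<xi> (chi D')"
proof -
  obtain p where p: "p permutes {..<K}" "p ` D = D'"
    using ex_permutes_image[OF _ assms(2-4)] by auto
  have "integ K \<xi> (\<lambda>x. chi D (act K p 1 x)) = integ K \<xi> (chi D)"
    by (rule integ_invariant[OF assms(1) p(1)]) simp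
  then show ?thesis by (simp add: chi_act[OF p(1) assms(2)] p(2))
qed

text \<open>The global sign change negates a monomial of odd degree but preserves its
  integral.\<close>

lemma integ_chi_odd:
  assumes "invariant K \<xi>" "D \<subseteq> {..<K}" "odd (card D)"
  shows "integ K \<xi> (chi D) = 0"
proof -
  have "integ K \<xi> (\<lambda>x. chi D (act K id (-1) x)) = integ K \<xi> (chi D)"
    by (rule integ_invariant[OF assms(1) permutes_id]) simp
  then have "integ K \<xi> (\<lambda>x. (-1) * chi D x) = integ K \<xi> (chi D)"
    by (simp add: chi_act[OF permutes_id assms(2)] assms(3))
  then show ?thesis unfolding integ_cmult by simp
qed

lemma integ_esum: "integ K \<xi> (esum I k) = (\<Sum>S | S \<subseteq> I \<and> card S = k. integ K \<xi> (chi S))"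
  unfolding integ_def esum_def sum_distrib_left by (rule sum.swap)

text \<open>Permutations act transitively on subsets of equal size, so all monomials of one degree
  share their integral. This trades a single monomial for a symmetric polynomial, which is a
  function of the coordinate sum.\<close>

lemma integ_chi_esum:
  assumes "invariant K \<xi>" "D \<subseteq> {..<K}"
  shows "real (K choose card D) * integ K \<xi> (chi D) = integ K \<xi> (esum {..<K} (card D))"
proof -
  have "integ K \<xi> (esum {..<K} (card D)) = (\<Sum>S | S \<subseteq> {..<K} \<and> card S = card D. integ K \<xi> (chi D))"
    unfolding integ_esum
    by (intro sum.cong refl) (use integ_chi_card[OF assms(1) _ assms(2)] in auto)
  then show ?thesis by (simp add: n_subsets)
qed

lemma integ_esum_2:
  "integ K \<xi> (esum {..<K} 2) = (integ K \<xi> (score2 K) - real K * integ K \<xi> (\<lambda>_. 1)) / 2"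
proof -
  have "integ K \<xi> (esum {..<K} 2) = integ K \<xi> (\<lambda>x. 1 / 2 * (score2 K x - real K))"
    by (rule integ_cong) (simp add: esum_score2)
  then show ?thesis unfolding integ_cmult integ_diff integ_const[of K \<xi> "real K"] by simp
qed

lemma integ_esum_4:
  "integ K \<xi> (esum {..<K} 4) = (integ K \<xi> (\<lambda>x. (score2 K x)\<^sup>2) - (6 * real K - 8) * integ K \<xi> (score2 K)
    + (3 * (real K)\<^sup>2 - 6 * real K) * integ K \<xi> (\<lambda>_. 1)) / 24"
proof -
  define c where "c = 3 * (real K)\<^sup>2 - 6 * real K"
  have "integ K \<xi> (esum {..<K} 4) = integ K \<xi> (\<lambda>x. 1 / 24 * ((score2 K x)\<^sup>2
      - (6 * real K - 8) * score2 K x + c))"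
    by (rule integ_cong) (simp add: esum_score2 c_def)
  then show ?thesis
    unfolding integ_cmult integ_diff integ_add integ_const[of K \<xi> c] by (simp add: c_def)
qed

text \<open>Odd degrees vanish, and the degrees 0, 2 and 4 are governed by the three given moments.
  The binomial coefficient can be cancelled, even for small \<open>K\<close>, because
  \<open>D\<close> itself is a subset of that size.\<close>

lemma integ_chi_eq:
  assumes inv: "invariant K \<xi>" "invariant K \<eta>"
    and D: "D \<subseteq> {..<K}" "card D \<le> 4"
    and m: "integ K \<xi> (\<lambda>_. 1) = integ K \<eta> (\<lambda>_. 1)" "integ K \<xi> (score2 K) = integ K \<eta> (score2 K)"
      "integ K \<xi> (\<lambda>x. (score2 K x)\<^sup>2) = integ K \<eta> (\<lambda>x. (score2 K x)\<^sup>2)"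
  shows "integ K \<xi> (chi D) = integ K \<eta> (chi D)"
proof (cases "odd (card D)")
  case True
  then show ?thesis using integ_chi_odd inv D by simp
next
  case False
  have "card D = 0 \<or> card D = 2 \<or> card D = 4"
    using D(2) False by presburger
  moreover have "esum {..<K} 0 = (\<lambda>_. 1)" by (rule ext) (simp add: esum_0)
  ultimately have "integ K \<xi> (esum {..<K} (card D)) = integ K \<eta> (esum {..<K} (card D))"
    using m by (elim disjE) (simp_all add: integ_esum_2 integ_esum_4)
  then have "real (K choose card D) * integ K \<xi> (chi D) = real (K choose card D) * integ K \<eta> (chi D)"
    by (simp only: integ_chi_esum[OF inv(1) D(1)] integ_chi_esum[OF inv(2) D(1)])
  moreover have "real (K choose card D) \<noteq> 0"
    using card_mono[OF _ D(1)] by simp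
  ultimately show ?thesis by (simp only: mult_cancel_left) simp
qed

lemma info_eq_integ_chi:
  assumes "r < num_params K" "s < num_params K"
  shows "info K \<xi> r s = integ K \<xi> (chi ((factor K r - factor K s) \<union> (factor K s - factor K r)))"
  unfolding info_def using chi_mult[OF _ factor_subset[OF assms(1)] factor_subset[OF assms(2)]]
  by (intro integ_cong) simp

text \<open>Every entry is the integral of the monomial over a symmetric difference of two sets of
  size at most two, hence of degree at most four.\<close>

lemma information_matrix_cong:
  assumes inv: "invariant K \<xi>" "invariant K \<eta>"
    and m: "integ K \<xi> (\<lambda>_. 1) = integ K \<eta> (\<lambda>_. 1)" "integ K \<xi> (score2 K) = integ K \<eta> (score2 K)"
      "integ K \<xi> (\<lambda>x. (score2 K x)\<^sup>2) = integ K \<eta> (\<lambda>x. (score2 K x)\<^sup>2)"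
  shows "information_matrix K \<xi> = information_matrix K \<eta>"
  unfolding information_matrix_eq
proof (rule cong_mat)
  fix r s assume rs: "r < num_params K" "s < num_params K"
  let ?D = "(factor K r - factor K s) \<union> (factor K s - factor K r)"
  have sub: "factor K r \<subseteq> {..<K}" "factor K s \<subseteq> {..<K}" using rs factor_subset by auto
  have "card ?D \<le> card (factor K r - factor K s) + card (factor K s - factor K r)"
    by (rule card_Un_le)
  also have "\<dots> \<le> card (factor K r) + card (factor K s)"
    using sub finite_subset by (intro add_mono card_mono) auto
  also have "\<dots> \<le> 4" using card_factor[OF rs(1)] card_factor[OF rs(2)] by simp
  finally have "integ K \<xi> (chi ?D) = integ K \<eta> (chi ?D)"
    using sub by (intro integ_chi_eq inv m) auto
  then show "(case (r, s) of (i, j) \<Rightarrow> info K \<xi> i j) = (case (r, s) of (i, j) \<Rightarrow> info K \<eta> i j)"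
    by (simp add: info_eq_integ_chi[OF rs])
qed simp_all

section \<open>The uniform design on the whole cube\<close>

definition uniform :: "nat \<Rightarrow> real vec \<Rightarrow> real" where
  "uniform K x = (if x \<in> cube K then 1 / real (card (cube K)) else 0)"

lemma cube_nonempty: "cube K \<noteq> {}"
proof -
  have "vec K (\<lambda>_. 1) \<in> cube K" by (auto simp: cube_def)
  then show ?thesis by blast
qed

lemma invariant_uniform: "invariant K (uniform K)"
  by (simp add: invariant_def uniform_def act_in_cube)

lemma integ_uniform_one: "integ K (uniform K) (\<lambda>_. 1) = 1"
  using cube_nonempty[of K] finite_cube[of K] by (simp add: integ_def uniform_def)

text \<open>Reversing a single coordinate in \<open>D\<close> is an involution of the cube that
  negates the monomial. The invariance group contains only the global sign change, so this is
  special to the uniform design.\<close>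

lemma integ_uniform_chi:
  assumes "D \<subseteq> {..<K}" "D \<noteq> {}"
  shows "integ K (uniform K) (chi D) = 0"
proof -
  obtain a where a: "a \<in> D" using assms(2) by blast
  define flip where "flip x = vec K (\<lambda>i. if i = a then - x $ i else x $ i)" for x :: "real vec"
  have fin: "finite D" using assms(1) finite_subset by blast
  have flip: "flip x \<in> cube K" "flip (flip x) = x" if "x \<in> cube K" for x
    using that by (auto simp: flip_def cube_def)
  have chi: "chi D (flip x) = - chi D x" for x
  proof -
    have "chi D (flip x) = flip x $ a * (\<Prod>i\<in>D - {a}. flip x $ i)"
      unfolding chi_def using fin a by (rule prod.remove)
    also have "(\<Prod>i\<in>D - {a}. flip x $ i) = (\<Prod>i\<in>D - {a}. x $ i)"
      using assms(1) by (intro prod.cong) (auto simp: flip_def)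
    also have "flip x $ a = - x $ a" using a assms(1) by (auto simp: flip_def)
    finally show ?thesis
      unfolding chi_def using prod.remove[OF fin a, of "\<lambda>i. x $ i"] by simp
  qed
  have "(\<Sum>x\<in>cube K. chi D x) = (\<Sum>x\<in>cube K. - chi D x)"
    by (rule sum.reindex_bij_witness[of _ flip flip]) (auto simp: flip chi)
  then have "(\<Sum>x\<in>cube K. chi D x) = 0" by (simp add: sum_negf)
  then show ?thesis
    by (simp add: integ_def uniform_def sum_divide_distrib[symmetric])
qed

lemma det_information_matrix_uniform: "det (information_matrix K (uniform K)) = 1"
proof -
  have "information_matrix K (uniform K) = fmat (num_params K) (\<lambda>r s. if r = s then 1 else 0)"
    unfolding information_matrix_eq
  proof (rule cong_mat)
    fix r s assume rs: "r < num_params K" "s < num_params K"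
    have "factor K r \<noteq> factor K s" if "r \<noteq> s"
      using bij_betw_imp_inj_on[OF bij_betw_factor[of K]] rs that by (auto simp: inj_on_def)
    then show "(case (r, s) of (i, j) \<Rightarrow> info K (uniform K) i j)
        = (case (r, s) of (i, j) \<Rightarrow> if i = j then 1 else 0)"
      using factor_subset[OF rs(1)] factor_subset[OF rs(2)]
      by (auto simp: info_eq_integ_chi[OF rs] chi_def[abs_def] integ_uniform_one
          intro!: integ_uniform_chi[unfolded chi_def[abs_def]])
  qed simp_all
  then show ?thesis by (simp add: det_diagonal)
qed

lemma integ_uniform_esum: "0 < k \<Longrightarrow> integ K (uniform K) (esum {..<K} k) = 0"
  unfolding integ_esum by (rule sum.neutral) (auto intro!: integ_uniform_chi)

lemma integ_uniform_score2: "integ K (uniform K) (score2 K) = real K"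
  using integ_esum_2[of K "uniform K"] by (simp add: integ_uniform_esum integ_uniform_one)

text \<open>The mean of the elementary symmetric polynomial of degree four vanishes; this is that
  equation solved for the second moment, with no count of orbits.\<close>

lemma integ_uniform_score2_square:
  "integ K (uniform K) (\<lambda>x. (score2 K x)\<^sup>2) = 3 * (real K)\<^sup>2 - 2 * real K"
  using integ_esum_4[of K "uniform K"]
  by (simp add: integ_uniform_esum integ_uniform_one integ_uniform_score2 algebra_simps power2_eq_square)

section \<open>Determinants under the group action and under averaging\<close>

lemma det_information_matrix_act:
  assumes p: "p permutes {..<K}" and c: "c \<in> {-1, 1}"
  shows "det (information_matrix K (\<lambda>x. \<xi> (act K p c x))) = det (information_matrix K \<xi>)"
proof -
  let ?q = "inv_into UNIV p" and ?P = "num_params K"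
  have q: "?q permutes {..<K}" by (rule permutes_inv[OF p])
  have "\<exists>s<?P. factor K s = ?q ` factor K r" if "r < ?P" for r
  proof -
    have "?q ` factor K r \<in> {S. S \<subseteq> {..<K} \<and> card S \<le> 2}"
      using factor_subset[OF that] card_factor[OF that] permutes_less[OF q]
        card_image[OF permutes_inj_on[OF q], of "factor K r"] by auto
    then show ?thesis
      using bij_betw_imp_surj_on[OF bij_betw_factor[of K]] by (metis (no_types, lifting) imageE lessThan_iff)
  qed
  \<comment> \<open>Substituting the inverse action turns the monomial over a set into the one over
    its image under the inverse permutation, times a power of \<open>c\<close>;
    \<open>\<sigma>\<close> is the resulting map of regressor indices.\<close>
  then obtain \<sigma> where \<sigma>: "\<And>r. r < ?P \<Longrightarrow> \<sigma> r < ?P \<and> factor K (\<sigma> r) = ?q ` factor K r"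
    by metis
  have inj: "inj_on \<sigma> {..<?P}"
  proof (rule inj_onI)
    fix r s assume rs: "r \<in> {..<?P}" "s \<in> {..<?P}" "\<sigma> r = \<sigma> s"
    then have "?q ` factor K r = ?q ` factor K s" using \<sigma> by (metis lessThan_iff)
    then have "factor K r = factor K s" using permutes_inj[OF q] by (simp add: inj_image_eq_iff)
    then show "r = s"
      using bij_betw_imp_inj_on[OF bij_betw_factor[of K]] rs by (auto simp: inj_on_def)
  qed
  let ?e = "\<lambda>r. c ^ card (factor K r)"
  have "info K (\<lambda>x. \<xi> (act K p c x)) r s = ?e r * ?e s * info K \<xi> (\<sigma> r) (\<sigma> s)"
    if rs: "r < ?P" "s < ?P" for r s
  proof -
    let ?h = "\<lambda>x. chi (factor K r) x * chi (factor K s) x"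
    have "info K (\<lambda>x. \<xi> (act K p c x)) r s = (\<Sum>x\<in>cube K. \<xi> (act K p c x) * ?h (act K ?q c (act K p c x)))"
      unfolding info_def integ_def using act_inverse[OF p c] by (intro sum.cong) auto
    also have "\<dots> = integ K \<xi> (\<lambda>x. ?h (act K ?q c x))"
      unfolding integ_def by (rule sum_act[OF p c])
    also have "\<dots> = integ K \<xi> (\<lambda>x. (?e r * ?e s) * (chi (factor K (\<sigma> r)) x * chi (factor K (\<sigma> s)) x))"
      using \<sigma>[OF rs(1)] \<sigma>[OF rs(2)]
      by (simp add: chi_act[OF q factor_subset[OF rs(1)]] chi_act[OF q factor_subset[OF rs(2)]] mult_ac)
    finally show ?thesis unfolding integ_cmult info_def .
  qed
  then have "information_matrix K (\<lambda>x. \<xi> (act K p c x)) = fmat ?P (\<lambda>r s. ?e r * ?e s * info K \<xi> (\<sigma> r) (\<sigma> s))"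
    unfolding information_matrix_eq by (intro cong_mat) auto
  moreover have "det (fmat ?P (\<lambda>r s. ?e r * ?e s * info K \<xi> (\<sigma> r) (\<sigma> s))) = det (fmat ?P (info K \<xi>))"
    using \<sigma> inj c by (intro det_signed_permutation) (auto simp: power_mult_distrib[symmetric])
  ultimately show ?thesis by (simp add: information_matrix_eq)
qed

lemma det_information_matrix_convex_ge:
  assumes "finite J" "\<And>j. j \<in> J \<Longrightarrow> 0 \<le> l j" "(\<Sum>j\<in>J. l j) = 1"
    and "\<And>j x. j \<in> J \<Longrightarrow> x \<in> cube K \<Longrightarrow> 0 \<le> \<xi> j x"
    and "0 < c" "\<And>j. j \<in> J \<Longrightarrow> c \<le> det (information_matrix K (\<xi> j))"
  shows "c \<le> det (information_matrix K (\<lambda>x. \<Sum>j\<in>J. l j * \<xi> j x))"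
  unfolding information_matrix_eq info_sum
  by (rule det_convex_combination_ge[OF assms(1-3) _ assms(5)])
    (use assms(4,6) in \<open>auto intro!: psd_info simp: information_matrix_eq\<close>)

definition symmetrized :: "nat \<Rightarrow> (real vec \<Rightarrow> real) \<Rightarrow> real vec \<Rightarrow> real" where
  "symmetrized K \<xi> x = (\<Sum>g\<in>signed_perms K. 1 / real (card (signed_perms K)) * \<xi> (act K (fst g) (snd g) x))"

lemma finite_signed_perms: "finite (signed_perms K)"
  by (simp add: finite_permutations)

lemma card_signed_perms_pos: "0 < card (signed_perms K)"
  using finite_signed_perms permutes_id by (subst card_gt_0_iff) blast

lemma invariant_symmetrized: "invariant K (symmetrized K \<xi>)"
  unfolding invariant_def
proof (intro allI impI)
  fix p :: "nat \<Rightarrow> nat" and c :: real and x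
  assume p: "p permutes {..<K}" and c: "c \<in> {-1, 1}"
  \<comment> \<open>Since \<open>act\<close> composes in reverse order, acting by
    \<open>(p, c)\<close> and then by \<open>g\<close> is acting by \<open>T g\<close>.\<close>
  define T where "T g = (p \<circ> fst g, c * snd g)" for g :: "(nat \<Rightarrow> nat) \<times> real"
  have "inj_on T (signed_perms K)"
  proof (rule inj_onI)
    fix g h assume "T g = T h"
    then have 1: "p \<circ> fst g = p \<circ> fst h" and 2: "c * snd g = c * snd h" by (auto simp: T_def)
    have "fst g = fst h"
      using fun_cong[OF 1] permutes_inj[OF p] by (auto simp: inj_def)
    with 2 c show "g = h" by (auto simp: prod_eq_iff)
  qed
  moreover have "T ` signed_perms K \<subseteq> signed_perms K"
    using p c by (auto simp: T_def intro: permutes_compose)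
  ultimately have bij: "bij_betw T (signed_perms K) (signed_perms K)"
    using finite_signed_perms by (simp add: bij_betw_def endo_inj_surj)
  let ?f = "\<lambda>g. 1 / real (card (signed_perms K)) * \<xi> (act K (fst g) (snd g) x)"
  have "symmetrized K \<xi> (act K p c x) = (\<Sum>g\<in>signed_perms K. ?f (T g))"
    unfolding symmetrized_def by (intro sum.cong refl) (auto simp: T_def act_act)
  also have "\<dots> = symmetrized K \<xi> x"
    unfolding symmetrized_def by (rule sum.reindex_bij_betw[OF bij])
  finally show "symmetrized K \<xi> (act K p c x) = symmetrized K \<xi> x" .
qed

lemma symmetrized_nonneg:
  assumes "\<And>x. x \<in> cube K \<Longrightarrow> 0 \<le> \<xi> x" "x \<in> cube K"
  shows "0 \<le> symmetrized K \<xi> x"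
  unfolding symmetrized_def
proof (intro sum_nonneg mult_nonneg_nonneg)
  fix g assume "g \<in> signed_perms K"
  then show "0 \<le> \<xi> (act K (fst g) (snd g) x)"
    using act_in_cube[OF _ _ assms(2)] by (intro assms(1)) auto
qed simp

text \<open>Ensures that averaging preserves the total mass and the position relative to the
  chord.\<close>

lemma integ_symmetrized:
  assumes "\<And>p c x. p permutes {..<K} \<Longrightarrow> c \<in> {-1, 1} \<Longrightarrow> h (act K p c x) = h x"
  shows "integ K (symmetrized K \<xi>) h = integ K \<xi> h"
proof -
  let ?n = "real (card (signed_perms K))"
  have "integ K (symmetrized K \<xi>) h
      = (\<Sum>g\<in>signed_perms K. \<Sum>x\<in>cube K. 1 / ?n * \<xi> (act K (fst g) (snd g) x) * h x)"
    unfolding integ_def symmetrized_def sum_distrib_right by (rule sum.swap)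
  also have "\<dots> = (\<Sum>g\<in>signed_perms K. 1 / ?n * integ K \<xi> h)"
  proof (rule sum.cong[OF refl])
    fix g assume g: "g \<in> signed_perms K"
    then have g': "fst g permutes {..<K}" "snd g \<in> {-1, 1}" by auto
    have "(\<Sum>x\<in>cube K. 1 / ?n * \<xi> (act K (fst g) (snd g) x) * h x)
        = (\<Sum>x\<in>cube K. 1 / ?n * \<xi> (act K (fst g) (snd g) x) * h (act K (fst g) (snd g) x))"
      by (simp only: assms[OF g'])
    also have "\<dots> = (\<Sum>x\<in>cube K. 1 / ?n * \<xi> x * h x)"
      by (rule sum_act[OF g', of "\<lambda>x. 1 / ?n * \<xi> x * h x"])
    finally show "(\<Sum>x\<in>cube K. 1 / ?n * \<xi> (act K (fst g) (snd g) x) * h x) = 1 / ?n * integ K \<xi> h"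
      by (simp add: integ_def sum_distrib_left mult.assoc)
  qed
  also have "\<dots> = integ K \<xi> h"
    using card_signed_perms_pos[of K] by (simp del: card_cartesian_product)
  finally show ?thesis .
qed

text \<open>All images of a design under the group share its determinant, and this common value
  serves as the positive threshold of quasi-concavity.\<close>

lemma det_information_matrix_symmetrized_ge:
  assumes "\<And>x. x \<in> cube K \<Longrightarrow> 0 \<le> \<xi> x" "0 < det (information_matrix K \<xi>)"
  shows "det (information_matrix K \<xi>) \<le> det (information_matrix K (symmetrized K \<xi>))"
  unfolding symmetrized_def[abs_def]
proof (rule det_information_matrix_convex_ge[OF finite_signed_perms _ _ _ assms(2)])
  show "(\<Sum>j\<in>signed_perms K. 1 / real (card (signed_perms K))) = 1"
    using card_signed_perms_pos[of K] by (simp del: card_cartesian_product)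
qed (use assms(1) act_in_cube det_information_matrix_act in auto)

text \<open>Squares of regressors are 1 on the cube, so every diagonal entry is the total mass and
  Hadamard's inequality applies.\<close>

lemma det_information_matrix_le_one:
  assumes "\<And>x. x \<in> cube K \<Longrightarrow> 0 \<le> \<xi> x" "integ K \<xi> (\<lambda>_. 1) = 1"
  shows "det (information_matrix K \<xi>) \<le> 1"
proof -
  have "info K \<xi> r r = 1" if "r < num_params K" for r
    using assms(2) by (simp add: info_eq_integ_chi[OF that that] chi_def[abs_def])
  then show ?thesis
    using hadamard_inequality[OF psd_info[of K \<xi> "num_params K"]] assms(1)
    by (simp add: information_matrix_eq)
qed

section \<open>Mixtures of orbit designs\<close>

lemma sum_cube_num_plus:
  assumes "x \<in> cube K"
  shows "(\<Sum>i<K. x $ i) = 2 * real (num_plus x) - real K"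
proof -
  have "(\<Sum>i<K. x $ i) = (\<Sum>i<K. 2 * (if x $ i = 1 then 1 else 0) - 1)"
    using assms by (intro sum.cong) (auto simp: cube_def)
  also have "\<dots> = 2 * (\<Sum>i<K. if x $ i = 1 then 1 else 0) - real K"
    by (simp add: sum_subtractf sum_distrib_left)
  also have "(\<Sum>i<K. if x $ i = 1 then 1 else 0 :: real) = real (card ({..<K} \<inter> {i. x $ i = 1}))"
    by (simp add: sum.If_cases)
  also have "{..<K} \<inter> {i. x $ i = 1} = {i. i < dim_vec x \<and> x $ i = 1}"
    using dim_vec_cube[OF assms] by auto
  finally show ?thesis by (simp add: num_plus_def)
qed

lemma num_plus_le:
  assumes "x \<in> cube K"
  shows "num_plus x \<le> K"
proof -
  have "num_plus x \<le> card {..<dim_vec x}"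
    unfolding num_plus_def by (rule card_mono) auto
  then show ?thesis using dim_vec_cube[OF assms] by simp
qed

lemma score2_num_plus: "x \<in> cube K \<Longrightarrow> score2 K x = (2 * real (num_plus x) - real K)\<^sup>2"
  by (simp add: score2_def sum_cube_num_plus)

text \<open>The coordinate sum is an injective affine function of \<open>num_plus\<close>, and the
  action multiplies it by \<open>c\<close>.\<close>

lemma num_plus_act:
  assumes "p permutes {..<K}" "c \<in> {-1, 1}" "x \<in> cube K"
  shows "num_plus (act K p c x) = (if c = 1 then num_plus x else K - num_plus x)"
proof -
  have "2 * real (num_plus (act K p c x)) - real K = c * (2 * real (num_plus x) - real K)"
    using sum_cube_num_plus[OF act_in_cube[OF assms]] sum_cube_num_plus[OF assms(3)]
      sum_act_nth[OF assms(1), of c x] by simp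
  with assms(2) num_plus_le[OF assms(3)] show ?thesis by (auto simp: of_nat_diff)
qed

lemma orbit_nonempty:
  assumes "k \<le> K"
  shows "orbit K k \<noteq> {}"
proof -
  let ?x = "vec K (\<lambda>i. if i < k then 1 else -1) :: real vec"
  have "{i. i < dim_vec ?x \<and> ?x $ i = 1} = {..<k}"
    using assms by (auto split: if_splits)
  then have "?x \<in> orbit K k"
    by (simp add: orbit_def num_plus_def cube_def)
  then show ?thesis by blast
qed

lemma finite_orbit: "finite (orbit K k)"
  using finite_cube by (simp add: orbit_def)

lemma card_orbit_pos: "k \<le> K \<Longrightarrow> 0 < card (orbit K k)"
  using orbit_nonempty finite_orbit by (simp add: card_gt_0_iff)

lemma card_orbit_reflect:
  assumes "k \<le> K"
  shows "card (orbit K (K - k)) = card (orbit K k)"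
proof (rule bij_betw_same_card)
  have id: "id permutes {..<K}" "(-1 :: real) \<in> {-1, 1}" by (simp_all add: permutes_id)
  have "inv_into UNIV id = (id :: nat \<Rightarrow> nat)" by simp
  note inverse = act_inverse[OF id, unfolded this]
  show "bij_betw (act K id (-1)) (orbit K (K - k)) (orbit K k)"
    by (rule bij_betw_byWitness[of _ "act K id (-1)"])
      (use assms num_plus_le inverse act_in_cube[OF id] num_plus_act[OF id] in
        \<open>auto simp: orbit_def\<close>)
qed

definition orbit_mixture :: "nat \<Rightarrow> (nat \<Rightarrow> real) \<Rightarrow> real vec \<Rightarrow> real" where
  "orbit_mixture K W x = (\<Sum>k\<le>K. W k * unif_design K k x)"

lemma orbit_mixture_cube:
  assumes "x \<in> cube K"
  shows "orbit_mixture K W x = W (num_plus x) / real (card (orbit K (num_plus x)))"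
proof -
  have "orbit_mixture K W x
      = (\<Sum>k\<le>K. if k = num_plus x then W k / real (card (orbit K k)) else 0)"
    unfolding orbit_mixture_def unif_design_def using assms
    by (intro sum.cong refl) (auto simp: orbit_def)
  then show ?thesis using num_plus_le[OF assms] by simp
qed

lemma orbit_mixture_notin_cube: "x \<notin> cube K \<Longrightarrow> orbit_mixture K W x = 0"
  by (simp add: orbit_mixture_def unif_design_def orbit_def)

lemma invariant_orbit_mixture:
  assumes "\<And>k. k \<le> K \<Longrightarrow> W k = W (K - k)"
  shows "invariant K (orbit_mixture K W)"
  unfolding invariant_def
proof (intro allI impI)
  fix p c x
  assume *: "p permutes {..<K}" "c \<in> {-1, 1 :: real}" "x \<in> cube K"
  show "orbit_mixture K W (act K p c x) = orbit_mixture K W x"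
    unfolding orbit_mixture_cube[OF act_in_cube[OF *]] orbit_mixture_cube[OF *(3)] num_plus_act[OF *]
    using assms[OF num_plus_le[OF *(3)]] card_orbit_reflect[OF num_plus_le[OF *(3)]] by simp
qed

lemma integ_orbit_mixture:
  assumes "\<And>x. x \<in> cube K \<Longrightarrow> h x = g (num_plus x)"
  shows "integ K (orbit_mixture K W) h = (\<Sum>k\<le>K. W k * g k)"
proof -
  have "integ K (orbit_mixture K W) h = (\<Sum>k\<le>K. \<Sum>x\<in>cube K. W k * unif_design K k x * h x)"
    unfolding integ_def orbit_mixture_def sum_distrib_right by (rule sum.swap)
  also have "\<dots> = (\<Sum>k\<le>K. W k * g k)"
  proof (intro sum.cong refl)
    fix k assume "k \<in> {..K}"
    have "(\<Sum>x\<in>cube K. W k * unif_design K k x * h x)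
        = (\<Sum>x\<in>orbit K k. W k * g k / real (card (orbit K k)))"
      by (rule sum.mono_neutral_cong_right[OF finite_cube])
        (auto simp: orbit_def unif_design_def assms)
    then show "(\<Sum>x\<in>cube K. W k * unif_design K k x * h x) = W k * g k"
      using card_orbit_pos[of k K] \<open>k \<in> {..K}\<close> by simp
  qed
  finally show ?thesis .
qed

lemma orbit_mixture_nonneg:
  assumes "\<And>k. 0 \<le> W k"
  shows "0 \<le> orbit_mixture K W x"
  unfolding orbit_mixture_def unif_design_def using assms by (intro sum_nonneg) auto

lemma design_orbit_mixture:
  assumes "\<And>k. 0 \<le> W k" "(\<Sum>k\<le>K. W k) = 1"
  shows "design K (orbit_mixture K W)"
  using orbit_mixture_nonneg[of W K] orbit_mixture_notin_cube[of _ K W] assms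
    integ_orbit_mixture[of K "\<lambda>_. 1" "\<lambda>_. 1" W]
  by (auto simp: design_def integ_def)

text \<open>A sum of conditionals instead of a case distinction, so that weights accumulate whenever
  some of the four orbits coincide.\<close>

definition mixed_weights :: "nat \<Rightarrow> nat \<Rightarrow> real \<Rightarrow> nat \<Rightarrow> real" where
  "mixed_weights K L w k = (if k = L then w else 0) + (if k = K div 2 then 1 / 2 - w else 0)
     + (if k = K - K div 2 then 1 / 2 - w else 0) + (if k = K - L then w else 0)"

lemma sum_mixed_weights:
  assumes "L \<le> K"
  shows "(\<Sum>k\<le>K. mixed_weights K L w k * g k)
    = w * g L + (1 / 2 - w) * g (K div 2) + (1 / 2 - w) * g (K - K div 2) + w * g (K - L)"
proof -
  have delta: "(\<Sum>k\<le>K. (if k = a then e else 0) * g k) = e * g a" if "a \<le> K" for a e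
  proof -
    have "(\<Sum>k\<le>K. (if k = a then e else 0) * g k) = (\<Sum>k\<le>K. if k = a then e * g k else 0)"
      by (intro sum.cong) auto
    with that show ?thesis by simp
  qed
  show ?thesis
    unfolding mixed_weights_def distrib_right sum.distrib using assms by (simp add: delta)
qed

text \<open>For even \<open>K\<close> both middle orbits coincide, which makes the two cases of the definition one.\<close>

lemma mixed_design_eq:
  assumes "L \<le> K"
  shows "mixed_design K L w = orbit_mixture K (mixed_weights K L w)"
proof
  fix x
  show "mixed_design K L w x = orbit_mixture K (mixed_weights K L w) x"
  proof (cases "even K")
    case True
    then have "K - K div 2 = K div 2" by presburger
    with True show ?thesis
      unfolding orbit_mixture_def sum_mixed_weights[OF assms] mixed_design_def
      by (simp add: algebra_simps)
  next
    case False
    then have "(K - 1) div 2 = K div 2" "(K + 1) div 2 = K - K div 2" by presburger+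
    with False show ?thesis
      unfolding orbit_mixture_def sum_mixed_weights[OF assms] mixed_design_def by simp
  qed
qed

lemma mixed_weights_symmetric:
  assumes "L \<le> K" "k \<le> K"
  shows "mixed_weights K L w k = mixed_weights K L w (K - k)"
proof -
  have "K - k = L \<longleftrightarrow> k = K - L" "K - k = K - L \<longleftrightarrow> k = L"
    "K - k = K div 2 \<longleftrightarrow> k = K - K div 2" "K - k = K - K div 2 \<longleftrightarrow> k = K div 2"
    using assms by linarith+
  then show ?thesis by (simp add: mixed_weights_def)
qed

lemma mixed_weights_nonneg: "w \<in> {0..1/2} \<Longrightarrow> 0 \<le> mixed_weights K L w k"
  by (simp add: mixed_weights_def)

section \<open>The chord through the middle and the extreme orbits\<close>

definition mid_score2 :: "nat \<Rightarrow> real" where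
  "mid_score2 K = (real K - 2 * real (K div 2))\<^sup>2"

definition end_score2 :: "nat \<Rightarrow> nat \<Rightarrow> real" where
  "end_score2 K L = (real K - 2 * real L)\<^sup>2"

text \<open>The coordinate sum has the parity of \<open>K\<close>, so its square is at least 0 for
  even and at least 1 for odd \<open>K\<close>; these are the two values of
  \<open>mid_score2\<close>.\<close>

lemma mid_score2_le:
  assumes "x \<in> cube K"
  shows "mid_score2 K \<le> score2 K x"
proof -
  let ?n = "num_plus x"
  have "\<bar>real K - 2 * real (K div 2)\<bar> \<le> \<bar>2 * real ?n - real K\<bar>"
  proof (cases "?n \<le> K div 2")
    case True
    then have "real ?n \<le> real (K div 2)" by simp
    moreover have "real (2 * (K div 2)) \<le> real K" by (simp only: of_nat_le_iff)
    ultimately show ?thesis by simp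
  next
    case False
    \<comment> \<open>By integrality \<open>2 * ?n - K\<close> is at least 1, which dominates the
      remainder of \<open>K\<close> modulo 2.\<close>
    then have "real (K + 1) \<le> real (2 * ?n)" by (simp only: of_nat_le_iff)
    moreover have "real (2 * (K div 2)) \<le> real K" "real K \<le> real (2 * (K div 2) + 1)"
      by (simp_all only: of_nat_le_iff)
    ultimately show ?thesis by simp
  qed
  then show ?thesis
    unfolding mid_score2_def score2_num_plus[OF assms] by (simp only: abs_le_square_iff)
qed

lemma score2_region_le:
  assumes "x \<in> region K L (K - L)" "L \<le> K"
  shows "score2 K x \<le> end_score2 K L"
proof -
  have x: "x \<in> cube K" "L \<le> num_plus x" "num_plus x \<le> K - L"
    using assms(1) by (auto simp: region_def)
  then have "real L \<le> real (num_plus x)" "real (num_plus x) \<le> real K - real L"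
    using assms(2) by (simp_all flip: of_nat_diff)
  then have "\<bar>2 * real (num_plus x) - real K\<bar> \<le> \<bar>real K - 2 * real L\<bar>" by simp
  then show ?thesis
    unfolding end_score2_def score2_num_plus[OF x(1)] by (simp only: abs_le_square_iff)
qed

text \<open>For total mass one its integral is the signed height of the pair of first and second
  moments of \<open>score2\<close> above the line through the chord.\<close>

definition mid_end_product :: "nat \<Rightarrow> nat \<Rightarrow> real vec \<Rightarrow> real" where
  "mid_end_product K L x = (score2 K x - mid_score2 K) * (score2 K x - end_score2 K L)"

lemma integ_mid_end_product:
  "integ K \<xi> (mid_end_product K L) = integ K \<xi> (\<lambda>x. (score2 K x)\<^sup>2)
    - (mid_score2 K + end_score2 K L) * integ K \<xi> (score2 K)
    + mid_score2 K * end_score2 K L * integ K \<xi> (\<lambda>_. 1)"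
proof -
  define a b where "a = mid_score2 K + end_score2 K L" and "b = mid_score2 K * end_score2 K L"
  have "integ K \<xi> (mid_end_product K L) = integ K \<xi> (\<lambda>x. (score2 K x)\<^sup>2 - a * score2 K x + b)"
    by (rule integ_cong) (simp add: mid_end_product_def a_def b_def algebra_simps power2_eq_square)
  then show ?thesis
    unfolding integ_add integ_diff integ_cmult integ_const[of K \<xi> b] by (simp add: a_def b_def)
qed

text \<open>
  The bound on \<open>L\<close> says exactly that the moments of the uniform design on the whole cube lie
  strictly above the chord through the middle and the extreme orbits.
\<close>

lemma integ_uniform_mid_end_product_pos:
  assumes "2 \<le> K" "lower_bound K < real L" "real L < real K / 2"
  shows "0 < integ K (uniform K) (mid_end_product K L)"
proof -
  have pos: "0 < real K - 2 * real L" using assms(3) by simp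
  have eq: "integ K (uniform K) (mid_end_product K L) = 3 * (real K)\<^sup>2 - 2 * real K
      - (mid_score2 K + end_score2 K L) * real K + mid_score2 K * end_score2 K L"
    by (simp add: integ_mid_end_product integ_uniform_one integ_uniform_score2 integ_uniform_score2_square)
  show ?thesis
  proof (cases "even K")
    case True
    then have mid: "mid_score2 K = 0" by (auto simp: mid_score2_def elim: evenE)
    have "real K - 2 * real L < sqrt (3 * real K - 2)"
      using assms(2) True by (simp add: lower_bound_def field_simps)
    then have "(real K - 2 * real L)\<^sup>2 < (sqrt (3 * real K - 2))\<^sup>2"
      using pos by (intro power_strict_mono) auto
    then have "end_score2 K L < 3 * real K - 2"
      using assms(1) by (simp add: end_score2_def)
    \<comment> \<open>With middle value 0 the integral factors as this product, whence the constant
      \<open>3 * K - 2\<close> under the root.\<close>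
    then have "0 < real K * (3 * real K - 2 - end_score2 K L)"
      using assms(1) by (intro mult_pos_pos) auto
    then show ?thesis unfolding eq mid by (simp add: algebra_simps power2_eq_square)
  next
    case False
    then have "real K - 2 * real (K div 2) = 1" by (auto elim: oddE)
    then have mid: "mid_score2 K = 1" by (simp add: mid_score2_def)
    have "real K - 2 * real L < sqrt (3 * real K)"
      using assms(2) False by (simp add: lower_bound_def field_simps)
    then have "(real K - 2 * real L)\<^sup>2 < (sqrt (3 * real K))\<^sup>2"
      using pos by (intro power_strict_mono) auto
    then have "end_score2 K L < 3 * real K"
      by (simp add: end_score2_def)
    \<comment> \<open>With middle value 1 the integral factors as this product instead, whence
      \<open>3 * K\<close> under the root for odd \<open>K\<close>.\<close>
    then have "0 < (real K - 1) * (3 * real K - end_score2 K L)"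
      using assms(1) by (intro mult_pos_pos) auto
    then show ?thesis unfolding eq mid by (simp add: algebra_simps power2_eq_square)
  qed
qed

text \<open>On the support of a mixed design \<open>score2\<close> takes only the extreme and the
  middle value, with masses \<open>2 * w\<close> and \<open>1 - 2 * w\<close>.\<close>

lemma integ_mixed_design:
  assumes "L \<le> K" "\<And>x. x \<in> cube K \<Longrightarrow> h x = f (score2 K x)"
  shows "integ K (mixed_design K L w) h = 2 * w * f (end_score2 K L) + (1 - 2 * w) * f (mid_score2 K)"
proof -
  let ?g = "\<lambda>k. f ((2 * real k - real K)\<^sup>2)"
  have "2 * real (K - K div 2) - real K = real K - 2 * real (K div 2)"
    "2 * real (K - L) - real K = real K - 2 * real L"
    using assms(1) by (simp_all add: of_nat_diff)
  then have g: "?g (K div 2) = f (mid_score2 K)" "?g (K - K div 2) = f (mid_score2 K)"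
    "?g L = f (end_score2 K L)" "?g (K - L) = f (end_score2 K L)"
    by (simp_all add: mid_score2_def end_score2_def power2_commute)
  have "integ K (mixed_design K L w) h = (\<Sum>k\<le>K. mixed_weights K L w k * ?g k)"
    unfolding mixed_design_eq[OF assms(1)]
    by (rule integ_orbit_mixture) (simp add: assms(2) score2_num_plus)
  also have "\<dots> = 2 * w * f (end_score2 K L) + (1 - 2 * w) * f (mid_score2 K)"
    unfolding sum_mixed_weights[OF assms(1)] g by (simp add: algebra_simps)
  finally show ?thesis .
qed

lemma mid_score2_le_end_score2:
  assumes "2 * L < K"
  shows "mid_score2 K \<le> end_score2 K L"
proof -
  have "real (2 * (K div 2)) \<le> real K" "real (2 * L) \<le> real (2 * (K div 2))"
    using assms by (simp_all only: of_nat_le_iff)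
  then show ?thesis
    unfolding mid_score2_def end_score2_def by (intro power_mono) auto
qed

text \<open>
  An invariant weighting whose moments lie on the chord is indistinguishable from a mixed design;
  the Cauchy--Schwarz inequality keeps the weight in range.
\<close>

lemma invariant_information_matrix_mixed:
  assumes LK: "2 * L < K" and inv: "invariant K \<xi>" and nonneg: "\<And>x. x \<in> cube K \<Longrightarrow> 0 \<le> \<xi> x"
    and one: "integ K \<xi> (\<lambda>_. 1) = 1" and chord: "integ K \<xi> (mid_end_product K L) = 0"
  shows "\<exists>v\<in>{0..1/2}. information_matrix K \<xi> = information_matrix K (mixed_design K L v)"
proof -
  define u where "u = integ K \<xi> (score2 K)"
  define a where "a = mid_score2 K"
  define b where "b = end_score2 K L"
  have L: "L \<le> K" using LK by simp
  have ab: "a \<le> b" unfolding a_def b_def by (rule mid_score2_le_end_score2[OF LK])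
  have m2: "integ K \<xi> (\<lambda>x. (score2 K x)\<^sup>2) = (a + b) * u - a * b"
    using chord by (simp add: integ_mid_end_product one u_def a_def b_def)
  \<comment> \<open>On the chord the variance of \<open>score2\<close> is
    \<open>(u - a) * (b - u)\<close>; being nonnegative, it places the mean between the two end
    values.\<close>
  have "integ K \<xi> (\<lambda>x. (score2 K x - u)\<^sup>2) = integ K \<xi> (\<lambda>x. (score2 K x)\<^sup>2 - 2 * u * score2 K x + u\<^sup>2)"
    by (rule integ_cong) (simp add: power2_diff algebra_simps)
  also have "\<dots> = (a + b) * u - a * b - u\<^sup>2"
    unfolding integ_add integ_diff integ_cmult integ_const[of K \<xi> "u\<^sup>2"] m2 one
    by (simp add: u_def power2_eq_square)
  also have "\<dots> = (u - a) * (b - u)"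
    by (simp add: algebra_simps power2_eq_square)
  moreover have "0 \<le> integ K \<xi> (\<lambda>x. (score2 K x - u)\<^sup>2)"
    unfolding integ_def by (intro sum_nonneg mult_nonneg_nonneg nonneg zero_le_power2)
  ultimately have "0 \<le> (u - a) * (b - u)" by simp
  then have u: "a \<le> u" "u \<le> b"
    using ab by (auto simp: zero_le_mult_iff)
  \<comment> \<open>The weight whose mixed design has mean \<open>u\<close>. For odd
    \<open>K\<close> and \<open>L = K div 2\<close> the values \<open>a\<close> and \<open>b\<close>
    coincide, and division by zero then gives the admissible weight 0.\<close>
  define v where "v = (u - a) / (2 * (b - a))"
  have v: "2 * v * (b - a) = u - a"
  proof (cases "b = a")
    case False
    then have "v * (2 * (b - a)) = u - a" by (simp add: v_def)
    then show ?thesis by (simp add: mult_ac)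
  qed (use u in \<open>simp add: v_def\<close>)
  have "v \<in> {0..1/2}"
    using u by (cases "b = a") (auto simp: v_def field_simps)
  moreover have "information_matrix K \<xi> = information_matrix K (mixed_design K L v)"
  proof (rule information_matrix_cong[OF inv])
    show "invariant K (mixed_design K L v)"
      unfolding mixed_design_eq[OF L]
      by (rule invariant_orbit_mixture) (rule mixed_weights_symmetric[OF L])
    show "integ K \<xi> (\<lambda>_. 1) = integ K (mixed_design K L v) (\<lambda>_. 1)"
      by (simp add: one integ_mixed_design[OF L, of "\<lambda>_. 1" "\<lambda>_. 1"])
    have "u = 2 * v * b + (1 - 2 * v) * a"
      using v by (simp add: algebra_simps)
    then show "integ K \<xi> (score2 K) = integ K (mixed_design K L v) (score2 K)"
      by (simp add: integ_mixed_design[OF L, of "score2 K" "\<lambda>t. t"] u_def a_def b_def)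
    have "(a + b) * u - a * b = a\<^sup>2 + (u - a) * (a + b)"
      by (simp add: algebra_simps power2_eq_square)
    also have "\<dots> = 2 * v * b\<^sup>2 + (1 - 2 * v) * a\<^sup>2"
      unfolding v[symmetric] by (simp add: algebra_simps power2_eq_square)
    finally show "integ K \<xi> (\<lambda>x. (score2 K x)\<^sup>2) = integ K (mixed_design K L v) (\<lambda>x. (score2 K x)\<^sup>2)"
      by (simp add: m2 integ_mixed_design[OF L, of "\<lambda>x. (score2 K x)\<^sup>2" "\<lambda>t. t\<^sup>2"] a_def b_def)
  qed
  ultimately show ?thesis by blast
qed

text \<open>The mixture \<open>\<theta>\<close> built in the proof may leave the region; it is a
  bridge, with determinant at least that of \<open>\<eta>\<close> and with the information matrix of
  a mixed design.\<close>

lemma det_information_matrix_le_mixed: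
  assumes K: "2 \<le> K" "lower_bound K < real L" "real L < real K / 2"
    and \<eta>: "design_on K (region K L (K - L)) \<eta>" and pos: "0 < det (information_matrix K \<eta>)"
  shows "\<exists>v\<in>{0..1/2}. det (information_matrix K \<eta>) \<le> det (information_matrix K (mixed_design K L v))"
proof -
  have LK: "2 * L < K" using K(3) by simp
  have nonneg: "0 \<le> \<eta> x" and supp: "\<eta> x \<noteq> 0 \<Longrightarrow> x \<in> region K L (K - L)" for x
    using \<eta> by (auto simp: design_on_def design_def)
  have one: "integ K \<eta> (\<lambda>_. 1) = 1"
    using \<eta> by (simp add: design_on_def design_def integ_def)
  define \<zeta> where "\<zeta> = symmetrized K \<eta>"
  have \<zeta>: "0 \<le> \<zeta> x" if "x \<in> cube K" for x
    unfolding \<zeta>_def using nonneg that by (rule symmetrized_nonneg)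
  have one\<zeta>: "integ K \<zeta> (\<lambda>_. 1) = 1"
    unfolding \<zeta>_def by (subst integ_symmetrized) (simp_all add: one)
  define s where "s = - integ K \<zeta> (mid_end_product K L)"
  define q where "q = integ K (uniform K) (mid_end_product K L)"
  have "integ K \<zeta> (mid_end_product K L) = integ K \<eta> (mid_end_product K L)"
    unfolding \<zeta>_def by (rule integ_symmetrized) (simp add: mid_end_product_def score2_act)
  also have "\<dots> \<le> 0"
    unfolding integ_def
  proof (rule sum_nonpos)
    fix x assume x: "x \<in> cube K"
    show "\<eta> x * mid_end_product K L x \<le> 0"
    proof (cases "\<eta> x = 0")
      case False
      have "mid_end_product K L x \<le> 0"
        unfolding mid_end_product_def
        using mid_score2_le[OF x] score2_region_le[OF supp[OF False]] LK by (intro mult_nonneg_nonpos) auto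
      with nonneg show ?thesis by (rule mult_nonneg_nonpos)
    qed simp
  qed
  finally have s: "0 \<le> s" by (simp add: s_def)
  have q: "0 < q" unfolding q_def by (rule integ_uniform_mid_end_product_pos[OF K])
  \<comment> \<open>The root of \<open>(1 - t) * (- s) + t * q = 0\<close>: the mixture crosses the
    chord exactly here, and \<open>0 \<le> s\<close> with \<open>0 < q\<close> keeps
    \<open>t\<close> in the unit interval.\<close>
  define t where "t = s / (s + q)"
  have t: "0 \<le> t" "t \<le> 1" using s q by (simp_all add: t_def)
  define \<theta> where "\<theta> = (\<lambda>x. (1 - t) * \<zeta> x + t * uniform K x)"
  have uniform_nonneg: "0 \<le> uniform K x" for x by (simp add: uniform_def)
  have inv: "invariant K \<theta>"
    using invariant_symmetrized[of K \<eta>] invariant_uniform[of K]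
    by (simp add: invariant_def \<theta>_def \<zeta>_def)
  have integ_\<theta>: "integ K \<theta> h = (1 - t) * integ K \<zeta> h + t * integ K (uniform K) h" for h
    unfolding \<theta>_def by (rule integ_weights_add)
  have "\<exists>v\<in>{0..1/2}. information_matrix K \<theta> = information_matrix K (mixed_design K L v)"
  proof (rule invariant_information_matrix_mixed[OF LK inv])
    show "0 \<le> \<theta> x" if "x \<in> cube K" for x
      using \<zeta>[OF that] uniform_nonneg t by (simp add: \<theta>_def)
    show "integ K \<theta> (\<lambda>_. 1) = 1"
      by (simp add: integ_\<theta> one\<zeta> integ_uniform_one)
    have "integ K \<theta> (mid_end_product K L) = (1 - t) * (- s) + t * q"
      by (simp add: integ_\<theta> s_def q_def)
    also have "\<dots> = 0" using s q by (simp add: t_def field_simps)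
    finally show "integ K \<theta> (mid_end_product K L) = 0" .
  qed
  moreover have "det (information_matrix K \<eta>) \<le> det (information_matrix K \<theta>)"
  proof -
    \<comment> \<open>Booleans index the two-point mixture. The determinant of \<open>\<eta>\<close>
      is a valid threshold for both parts: averaging does not lower it, and it is at most 1, the
      determinant of the uniform design.\<close>
    let ?l = "\<lambda>b. if b then t else 1 - t" and ?\<xi> = "\<lambda>b. if b then uniform K else \<zeta>"
    have "det (information_matrix K \<eta>) \<le> det (information_matrix K (\<lambda>x. \<Sum>b\<in>UNIV. ?l b * ?\<xi> b x))"
    proof (rule det_information_matrix_convex_ge[OF _ _ _ _ pos])
      show "det (information_matrix K \<eta>) \<le> det (information_matrix K (?\<xi> b))" for b
        using det_information_matrix_le_one[of K \<eta>] nonneg one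
          det_information_matrix_symmetrized_ge[of K \<eta>] pos
        by (simp add: det_information_matrix_uniform \<zeta>_def)
    qed (use t \<zeta> uniform_nonneg in \<open>auto simp: UNIV_bool\<close>)
    then show ?thesis by (simp add: UNIV_bool \<theta>_def add.commute)
  qed
  ultimately show ?thesis by metis
qed

theorem theorem2:
  fixes K L :: nat and w :: real
  assumes "2 \<le> K"
    and "lower_bound K < real L" and "real L < real K / 2"
    and "w \<in> {0..1/2}"
    and "\<And>v. v \<in> {0..1/2} \<Longrightarrow>
      det (information_matrix K (mixed_design K L v)) \<le> det (information_matrix K (mixed_design K L w))"
  shows "symmetric_invariant K (mixed_design K L w) \<and>
    D_optimal_on K (region K L (K - L)) (mixed_design K L w)"
proof
  have LK: "2 * L < K" using assms(3) by simp
  then have L: "L \<le> K" by simp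
  let ?W = "mixed_weights K L w"
  have sum1: "(\<Sum>k\<le>K. ?W k) = 1"
    using sum_mixed_weights[OF L, of w "\<lambda>_. 1"] by simp
  show "symmetric_invariant K (mixed_design K L w)"
    unfolding symmetric_invariant_def
    by (intro exI[of _ ?W] conjI allI impI mixed_weights_nonneg[OF assms(4)] sum1
        mixed_weights_symmetric[OF L])
      (simp_all add: mixed_design_eq[OF L] orbit_mixture_def[abs_def])
  have design: "design K (mixed_design K L w)"
    unfolding mixed_design_eq[OF L]
    by (rule design_orbit_mixture) (simp_all add: mixed_weights_nonneg[OF assms(4)] sum1)
  have supp: "x \<in> region K L (K - L)" if "mixed_design K L w x \<noteq> 0" for x
  proof -
    have x: "x \<in> cube K"
      using that orbit_mixture_notin_cube mixed_design_eq[OF L] by metis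
    have "?W (num_plus x) \<noteq> 0"
      using that orbit_mixture_cube[OF x] mixed_design_eq[OF L] by auto
    then have "num_plus x \<in> {L, K div 2, K - K div 2, K - L}"
      by (auto simp: mixed_weights_def split: if_splits)
    then show ?thesis using x LK by (auto simp: region_def)
  qed
  have "det (information_matrix K \<eta>) \<le> det (information_matrix K (mixed_design K L w))"
    if "design_on K (region K L (K - L)) \<eta>" for \<eta>
  proof (cases "0 < det (information_matrix K \<eta>)")
    case True
    then show ?thesis
      using det_information_matrix_le_mixed[OF assms(1-3) that] assms(5) order_trans by blast
  next
    case False
    \<comment> \<open>A competitor without positive determinant is out of reach of the logarithmic
      argument, but semidefiniteness of the mixed design's matrix settles it.\<close>
    have "0 \<le> det (information_matrix K (mixed_design K L w))"
      unfolding information_matrix_eq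
      using design by (intro psd_det_nonneg psd_info) (simp add: design_def)
    with False show ?thesis by simp
  qed
  then show "D_optimal_on K (region K L (K - L)) (mixed_design K L w)"
    using design supp by (auto simp: D_optimal_on_def design_on_def)
qed

end
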